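(* The mapping from biradial measures to complex Jacobi parameters is surjective: for every sequence $\{\alpha_j\}_{j=1}^\infty$ of complex numbers and every sequence $\{\beta_j\}_{j=1}^\infty$ of positive real numbers (no boundedness assumed), there exists a biradial measure $\rho$ on $\mathbb{C}$ with finite moments whose Jacobi parameters are $\{\alpha_j\}_{j=1}^\infty$, $\{\beta_j\}_{j=1}^\infty$.
   Context: Biradial measures. Write $\mathbb{R}^+=[0,\infty)$. Let $\rho_1^+,\rho_2^+$ be positive Borel measures on $\mathbb{R}^+$ with $\rho_1^+(\mathbb{R}^+)+\rho_2^+(\mathbb{R}^+)=1$, and let $\phi_1,\phi_2:\mathbb{R}^+\to\mathbb{R}$ be Borel measurable. For Borel $E\subset\mathbb{C}$ put $\rho_j(E)=\rho_j^+(\{r\ge0: re^{i\phi_j(r)}\in E\})$, $j=1,2$. The probability measure $\rho=\rho_1+\rho_2$ on $\mathbb{C}$ is called a biradial measure. It has finite moments if $\int_{\mathbb{C}}|\lambda|^n\,d\rho(\lambda)<\infty$ for all $n\ge0$. Polynomials. For integers $k\ge0$ define the monomials $\langle\lambda\rangle^k=|\lambda|^k$ if $k$ is even and $\langle\lambda\rangle^k=\lambda|\lambda|^{k-1}$ if $k$ is odd. $\mathcal{P}(r2)$ is the complex span of all $\langle\lambda\rangle^k$; the degree of a nonzero element is the largest $k$ for which the coefficient of $\langle\lambda\rangle^k$ is nonzero. Jacobi parameters. Let $\rho$ be a Borel probability measure on $\mathbb{C}$ with finite moments, and put $\langle p,q\rangle=\int_{\mathbb{C}}p\overline{q}\,d\rho$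 on $\mathcal{P}(r2)$. If the monomials $1,\langle\lambda\rangle^1,\langle\lambda\rangle^2,\dots$ are linearly independent in $L^2(\rho)$, the Gram–Schmidt process applied to them gives orthonormal polynomials $p_0,p_1,p_2,\dots$, $p_j$ of degree $j$ with positive leading coefficient, and these satisfy $$\beta_{j+1}p_{j+1}(\lambda)=\lambda\overline{p_j(\lambda)}-\alpha_{j+1}p_j(\lambda)-\beta_jp_{j-1}(\lambda),\quad j=0,1,2,\dots,$$ with $p_{-1}\equiv0$, $\alpha_{j+1}=\langle\lambda\overline{p_j},p_j\rangle\in\mathbb{C}$ and $\beta_{j+1}=\langle\lambda\overline{p_j},p_{j+1}\rangle>0$. The sequences $\{\alpha_j\}_{j=1}^\infty,\{\beta_j\}_{j=1}^\infty$ are the Jacobi parameters corresponding to $\rho$. Thus the claim includes that the process does not break down for $\rho$. *)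

theory Defs
  imports "HOL-Analysis.Analysis"
begin

text \<open>Positive Borel measures on \<open>\<real>\<^sup>+ = [0,\<infinity>)\<close> are measures on the measurable space
  \<open>restrict_space borel {0..}\<close>; either of the two may be zero. The point
  \<open>r e\<^sup>i\<^sup>\<phi>\<close> is \<open>rcis r \<phi>\<close>.\<close>

definition biradial_measure :: "complex measure \<Rightarrow> bool" where
  "biradial_measure \<rho> \<longleftrightarrow> sets \<rho> = sets borel \<and>
    (\<exists>(\<rho>1 :: real measure) (\<rho>2 :: real measure) (\<phi>1 :: real \<Rightarrow> real) (\<phi>2 :: real \<Rightarrow> real).
        sets \<rho>1 = sets (restrict_space borel {0..}) \<and>
        sets \<rho>2 = sets (restrict_space borel {0..}) \<and>
        emeasure \<rho>1 {0..} + emeasure \<rho>2 {0..} = 1 \<and>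
        \<phi>1 \<in> borel_measurable (restrict_space borel {0..}) \<and>
        \<phi>2 \<in> borel_measurable (restrict_space borel {0..}) \<and>
        (\<forall>E \<in> sets borel. emeasure \<rho> E =
            emeasure \<rho>1 {r. 0 \<le> r \<and> rcis r (\<phi>1 r) \<in> E} +
            emeasure \<rho>2 {r. 0 \<le> r \<and> rcis r (\<phi>2 r) \<in> E}))"

definition finite_moments :: "complex measure \<Rightarrow> bool" where
  "finite_moments \<rho> \<longleftrightarrow> (\<forall>n::nat. integrable \<rho> (\<lambda>z. cmod z ^ n))"

definition r2_monom :: "nat \<Rightarrow> complex \<Rightarrow> complex" where
  "r2_monom k z = (if even k then of_real (cmod z ^ k) else z * of_real (cmod z ^ (k - 1)))"

definition L2_inner :: "complex measure \<Rightarrow> (complex \<Rightarrow> complex) \<Rightarrow> (complex \<Rightarrow> complex) \<Rightarrow> complex" where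
  "L2_inner \<rho> p q = (LINT z|\<rho>. p z * cnj (q z))"

definition L2_norm :: "complex measure \<Rightarrow> (complex \<Rightarrow> complex) \<Rightarrow> real" where
  "L2_norm \<rho> p = sqrt (LINT z|\<rho>. (cmod (p z))\<^sup>2)"

definition r2_monoms_independent :: "complex measure \<Rightarrow> bool" where
  "r2_monoms_independent \<rho> \<longleftrightarrow>
    (\<forall>n (c :: nat \<Rightarrow> complex).
       (AE z in \<rho>. (\<Sum>k\<le>n. c k * r2_monom k z) = 0) \<longrightarrow> (\<forall>k\<le>n. c k = 0))"

text \<open>Gram--Schmidt applied to the monomials. If these are independent in \<open>L\<^sup>2(\<rho>)\<close>, then
  \<open>orth_poly \<rho> n\<close> has degree \<open>n\<close> and a positive leading coefficient, namely
  the reciprocal of the norm in the denominator; otherwise some step divides by zero.\<close>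

declare sum.cong [fundef_cong]

fun orth_poly :: "complex measure \<Rightarrow> nat \<Rightarrow> complex \<Rightarrow> complex" where
  "orth_poly \<rho> n =
    (let q = (\<lambda>z. r2_monom n z -
                  (\<Sum>j<n. L2_inner \<rho> (r2_monom n) (orth_poly \<rho> j) * orth_poly \<rho> j z))
     in (\<lambda>z. q z / of_real (L2_norm \<rho> q)))"

declare orth_poly.simps [simp del]
declare sum.cong [fundef_cong del]

text \<open>The sequences are indexed from 1, so \<open>\<alpha> 0\<close> and \<open>\<beta> 0\<close> play no role.\<close>

definition jacobi_parameters ::
  "complex measure \<Rightarrow> (nat \<Rightarrow> complex) \<Rightarrow> (nat \<Rightarrow> real) \<Rightarrow> bool" where
  "jacobi_parameters \<rho> \<alpha> \<beta> \<longleftrightarrow>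
    r2_monoms_independent \<rho> \<and>
    (\<forall>j. \<alpha> (j + 1) = L2_inner \<rho> (\<lambda>z. z * cnj (orth_poly \<rho> j z)) (orth_poly \<rho> j) \<and>
         of_real (\<beta> (j + 1)) =
           L2_inner \<rho> (\<lambda>z. z * cnj (orth_poly \<rho> j z)) (orth_poly \<rho> (j + 1)))"

end

theory Submission
  imports Defs "HOL-Probability.Helly_Selection"
begin

text \<open>Let \<open>P\<^sub>j\<close> be the polynomials defined by the recurrence. The truncated Jacobi matrix \<open>J\<close> is complex
  symmetric, so the antilinear map \<open>v \<mapsto> J v\<^sup>*\<close> (with \<open>v\<^sup>*\<close> the complex conjugate) has an
  orthonormal basis of vectors with \<open>J v\<^sup>* = s v\<close>, \<open>s\<close> real (Takagi). Changing the phase of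
  \<open>v\<close> turns this equation into the recurrence at the point \<open>\<lambda> = s v\<^sub>0 / v\<^sub>0\<^sup>*\<close>, hence
  the masses \<open>|v\<^sub>0|\<^sup>2\<close> at these points form a measure for which \<open>P\<^sub>0, \<dots>, P\<^sub>N\<close> are orthonormal.

  All inner products in question are values of, or conjugates of, integrals of \<open>|\<lambda>|\<^sup>2\<^sup>m\<close> and
  \<open>\<lambda>|\<lambda>|\<^sup>2\<^sup>m\<close>. They involve only the distribution of \<open>|\<lambda>|\<close> and the conditional mean
  \<open>g\<close> of the phase given \<open>|\<lambda>|\<close>, where \<open>|g| \<le> 1\<close>. Helly's theorem on the line, applied to the
  distribution of \<open>|\<lambda>|\<close> and to its perturbations by the real and imaginary parts of the
  phase, therefore produces a limit of the discrete measures. Finally every point of the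
  closed unit disc is the midpoint of two points of the unit circle, so the limit can be realized by
  two phases on each circle, that is, by a biradial measure.\<close>

section \<open>Con-eigenvectors of complex symmetric matrices\<close>

text \<open>Vectors of C^N are functions on \<open>nat\<close>: only the coordinates below
  \<open>N\<close> enter, and vanishing beyond is demanded separately wherever vectors are compared
  as functions.\<close>

definition vec_inner :: "nat \<Rightarrow> (nat \<Rightarrow> complex) \<Rightarrow> (nat \<Rightarrow> complex) \<Rightarrow> complex" where
  "vec_inner N u v = (\<Sum>i<N. u i * cnj (v i))"

text \<open>The value 0 from \<open>N\<close> on allows eigenvalue equations to be stated as
  equalities of functions.\<close>

definition conj_apply :: "(nat \<Rightarrow> nat \<Rightarrow> complex) \<Rightarrow> nat \<Rightarrow> (nat \<Rightarrow> complex) \<Rightarrow> nat \<Rightarrow> complex" where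
  "conj_apply J N v i = (if i < N then \<Sum>j<N. J i j * cnj (v j) else 0)"

lemma cnj_vec_inner: "cnj (vec_inner N u v) = vec_inner N v u"
  by (simp add: vec_inner_def mult.commute)

lemma vec_inner_add:
  "vec_inner N (\<lambda>i. u i + v i) w = vec_inner N u w + vec_inner N v w"
  "vec_inner N w (\<lambda>i. u i + v i) = vec_inner N w u + vec_inner N w v"
  by (simp_all add: vec_inner_def sum.distrib algebra_simps)

lemma vec_inner_diff:
  "vec_inner N (\<lambda>i. u i - v i) w = vec_inner N u w - vec_inner N v w"
  "vec_inner N w (\<lambda>i. u i - v i) = vec_inner N w u - vec_inner N w v"
  by (simp_all add: vec_inner_def sum_subtractf algebra_simps)

lemma vec_inner_scale:
  "vec_inner N (\<lambda>i. a * u i) w = a * vec_inner N u w"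
  "vec_inner N w (\<lambda>i. a * u i) = cnj a * vec_inner N w u"
  by (simp_all add: vec_inner_def sum_distrib_left algebra_simps)

lemma vec_inner_sum_left:
  "vec_inner N (\<lambda>i. \<Sum>v\<in>V. c v * v i) w = (\<Sum>v\<in>V. c v * vec_inner N v w)"
proof -
  have "vec_inner N (\<lambda>i. \<Sum>v\<in>V. c v * v i) w = (\<Sum>i<N. \<Sum>v\<in>V. c v * (v i * cnj (w i)))"
    by (simp add: vec_inner_def sum_distrib_right mult.assoc)
  also have "\<dots> = (\<Sum>v\<in>V. \<Sum>i<N. c v * (v i * cnj (w i)))"
    by (rule sum.swap)
  finally show ?thesis by (simp add: vec_inner_def sum_distrib_left)
qed

lemma vec_inner_self: "vec_inner N u u = of_real (\<Sum>i<N. (cmod (u i))\<^sup>2)"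
  by (simp add: vec_inner_def complex_norm_square del: of_real_power)

lemma vec_inner_self_eq_0D: "vec_inner N u u = 0 \<Longrightarrow> i < N \<Longrightarrow> u i = 0"
  unfolding vec_inner_self of_real_eq_0_iff by (subst (asm) sum_nonneg_eq_0_iff) auto

lemma vec_inner_self_nonneg: "0 \<le> Re (vec_inner N u u)"
  by (simp add: vec_inner_self sum_nonneg)

text \<open>The factor is the reciprocal of the norm. Its square is recorded as well, because
  quadratic forms scale by it.\<close>

lemma vec_inner_normalize:
  assumes "vec_inner N x x \<noteq> 0"
  shows "\<exists>r :: real. r > 0 \<and> r\<^sup>2 * Re (vec_inner N x x) = 1 \<and>
    vec_inner N (\<lambda>i. of_real r * x i) (\<lambda>i. of_real r * x i) = 1"
proof -
  define q where "q = Re (vec_inner N x x)"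
  have xq: "vec_inner N x x = of_real q" by (simp add: q_def vec_inner_self)
  have "q \<noteq> 0" using assms xq by simp
  moreover have "q \<ge> 0" unfolding q_def by (rule vec_inner_self_nonneg)
  ultimately have q: "q > 0" by simp
  define r where "r = 1 / sqrt q"
  have r: "r > 0" "r\<^sup>2 * q = 1" using q by (simp_all add: r_def power_divide)
  have "vec_inner N (\<lambda>i. of_real r * x i) (\<lambda>i. of_real r * x i) = of_real (r\<^sup>2 * q)"
    by (simp add: vec_inner_scale xq power2_eq_square)
  with r show ?thesis by (auto simp: q_def)
qed

lemma conj_apply_add:
  "conj_apply J N (\<lambda>i. u i + v i) = (\<lambda>i. conj_apply J N u i + conj_apply J N v i)"
  by (auto simp: conj_apply_def sum.distrib algebra_simps)

lemma conj_apply_scale: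
  "conj_apply J N (\<lambda>i. a * u i) = (\<lambda>i. cnj a * conj_apply J N u i)"
  by (auto simp: conj_apply_def sum_distrib_left algebra_simps)

text \<open>Symmetry without conjugation replaces self-adjointness: the antilinear map passes to the
  other vector while the two exchange places. Invariance of orthogonal complements and equality of
  the cross terms of the quadratic form rest on this.\<close>

lemma vec_inner_conj_apply_swap:
  assumes sym: "\<And>i j. i < N \<Longrightarrow> j < N \<Longrightarrow> J i j = J j i"
  shows "vec_inner N (conj_apply J N u) v = vec_inner N (conj_apply J N v) u"
proof -
  have "vec_inner N (conj_apply J N u) v = (\<Sum>i<N. \<Sum>j<N. J i j * cnj (u j) * cnj (v i))"
    by (simp add: vec_inner_def conj_apply_def sum_distrib_right)
  also have "\<dots> = (\<Sum>j<N. \<Sum>i<N. J i j * cnj (u j) * cnj (v i))"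
    by (rule sum.swap)
  also have "\<dots> = (\<Sum>j<N. \<Sum>i<N. J j i * cnj (v i) * cnj (u j))"
    by (intro sum.cong refl) (auto simp: sym)
  also have "\<dots> = vec_inner N (conj_apply J N v) u"
    by (simp add: vec_inner_def conj_apply_def sum_distrib_right)
  finally show ?thesis .
qed

section \<open>Maximizers of the quadratic form\<close>

text \<open>For small positive \<open>t\<close> the linear term outweighs the quadratic one, so a
  positive \<open>a\<close> would make the expression negative.\<close>

lemma quadratic_nonneg_linear_coeff_eq_0:
  fixes a c :: real
  assumes "0 \<le> a" and nonneg: "\<And>t. 0 \<le> t\<^sup>2 * c - 2 * t * a"
  shows "a = 0"
proof (rule ccontr)
  assume "a \<noteq> 0"
  \<comment> \<open>Any positive number above \<open>c\<close> serves: at \<open>a / d\<close> the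
    value is \<open>(a / d)\<^sup>2 * (c - 2 * d)\<close>, which is negative.\<close>
  define d where "d = \<bar>c\<bar> + 1"
  have d: "d > 0" "c < d" by (auto simp: d_def)
  have "0 \<le> (a / d)\<^sup>2 * c - 2 * (a / d) * a" by (rule nonneg)
  also have "\<dots> = (a / d)\<^sup>2 * (c - 2 * d)"
    using d by (simp add: field_simps power2_eq_square)
  also have "\<dots> < 0"
    using \<open>a \<noteq> 0\<close> d by (intro mult_pos_neg) auto
  finally show False by simp
qed

text \<open>Let \<open>s\<close> be the maximum and \<open>u\<close> the residual of the eigenvalue equation. The form minus
  \<open>s\<close> times the squared norm, evaluated at \<open>v + t u\<close> for real \<open>t\<close>, is a nonpositive quadratic
  polynomial in \<open>t\<close> with linear coefficient \<open>2 \<parallel>u\<parallel>\<^sup>2\<close>, which therefore vanishes.\<close>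

lemma coneigenvector_if_maximizes:
  fixes N :: nat and V :: "(nat \<Rightarrow> complex) set"
  defines "W \<equiv> {w. (\<forall>i\<ge>N. w i = 0) \<and> (\<forall>u\<in>V. vec_inner N w u = 0)}"
  assumes sym: "\<And>i j. i < N \<Longrightarrow> j < N \<Longrightarrow> J i j = J j i"
    and inv: "\<And>w. w \<in> W \<Longrightarrow> conj_apply J N w \<in> W"
    and v: "v \<in> W" "vec_inner N v v = 1"
    and max: "\<And>w. w \<in> W \<Longrightarrow> vec_inner N w w = 1 \<Longrightarrow>
      Re (vec_inner N (conj_apply J N w) w) \<le> Re (vec_inner N (conj_apply J N v) v)"
  shows "\<exists>s :: real. conj_apply J N v = (\<lambda>i. of_real s * v i)"
proof -
  define F where "F w = Re (vec_inner N (conj_apply J N w) w)" for w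
  define s where "s = F v"
  \<comment> \<open>By homogeneity the maximum over unit vectors bounds the form on all of
    \<open>W\<close>.\<close>
  have F_le: "F w \<le> s * Re (vec_inner N w w)" if w: "w \<in> W" for w
  proof (cases "vec_inner N w w = 0")
    case True
    then have "\<And>i. i < N \<Longrightarrow> w i = 0" by (rule vec_inner_self_eq_0D)
    then have "F w = 0" by (simp add: F_def vec_inner_def)
    with True show ?thesis by simp
  next
    case False
    then obtain r :: real where r: "r > 0" "r\<^sup>2 * Re (vec_inner N w w) = 1"
      "vec_inner N (\<lambda>i. of_real r * w i) (\<lambda>i. of_real r * w i) = 1"
      using vec_inner_normalize by blast
    have "F (\<lambda>i. of_real r * w i) \<le> s"
      unfolding F_def s_def
      using w r(3) by (intro max) (auto simp: W_def vec_inner_scale)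
    moreover have "F (\<lambda>i. of_real r * w i) = r\<^sup>2 * F w"
      by (simp add: F_def conj_apply_scale vec_inner_scale power2_eq_square)
    ultimately have "r\<^sup>2 * F w \<le> r\<^sup>2 * (s * Re (vec_inner N w w))"
      using r(2) by (simp add: algebra_simps)
    then show ?thesis using r(1) by simp
  qed
  define u where "u = (\<lambda>i. conj_apply J N v i - of_real s * v i)"
  have u: "u \<in> W" using inv[OF v(1)] v(1) by (simp add: u_def W_def vec_inner_diff vec_inner_scale)
  define a where "a = Re (vec_inner N u u)"
  have a0: "0 \<le> a" by (simp add: a_def vec_inner_self_nonneg)
  \<comment> \<open>Splitting \<open>conj_apply J N v\<close> into \<open>u\<close> and
    \<open>s\<close> times \<open>v\<close> exposes the squared norm of the residual in the linear
    coefficient.\<close>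
  have a_eq: "Re (vec_inner N (conj_apply J N v) u) = a + s * Re (vec_inner N v u)"
  proof -
    have "vec_inner N u u = vec_inner N (conj_apply J N v) u - of_real s * vec_inner N v u"
      by (subst u_def) (simp add: vec_inner_diff vec_inner_scale)
    then show ?thesis by (simp add: a_def)
  qed
  have "0 \<le> t\<^sup>2 * (s * a - F u) - 2 * t * a" for t :: real
  proof -
    define w where "w = (\<lambda>i. v i + of_real t * u i)"
    have "w \<in> W" using v(1) u by (simp add: w_def W_def vec_inner_add vec_inner_scale)
    then have le: "F w \<le> s * Re (vec_inner N w w)" by (rule F_le)
    have "vec_inner N u v = cnj (vec_inner N v u)" by (simp add: cnj_vec_inner)
    then have n: "Re (vec_inner N w w) = 1 + 2 * t * Re (vec_inner N v u) + t\<^sup>2 * a"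
      by (simp add: w_def vec_inner_add vec_inner_scale v(2) a_def
          algebra_simps power2_eq_square)
    have "vec_inner N (conj_apply J N u) v = vec_inner N (conj_apply J N v) u"
      by (rule vec_inner_conj_apply_swap) (rule sym)
    then have f: "F w = s + 2 * t * Re (vec_inner N (conj_apply J N v) u) + t\<^sup>2 * F u"
      by (simp add: F_def w_def conj_apply_add conj_apply_scale vec_inner_add vec_inner_scale
          s_def algebra_simps power2_eq_square)
    \<comment> \<open>The constant terms cancel since \<open>v\<close> has norm 1 and form value
      \<open>s\<close>; the terms with the inner product of \<open>v\<close> and \<open>u\<close>
      cancel by \<open>a_eq\<close>.\<close>
    show ?thesis using le unfolding n f a_eq by (simp add: algebra_simps)
  qed
  with a0 have "a = 0" by (rule quadratic_nonneg_linear_coeff_eq_0)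
  then have "vec_inner N u u = 0" by (simp add: a_def vec_inner_self)
  then have "u i = 0" if "i < N" for i using that by (rule vec_inner_self_eq_0D)
  then have "conj_apply J N v i = of_real s * v i" for i
    using v(1) by (cases "i < N") (auto simp: u_def W_def conj_apply_def)
  then show ?thesis by blast
qed

section \<open>Bessel's inequality and complete orthonormal systems\<close>

text \<open>Here \<open>w\<close> is the \<open>i\<close>-th standard basis vector minus its
  orthogonal projection onto the span of \<open>V\<close>. Being orthogonal to \<open>V\<close>, it
  has squared norm equal to its inner product with the basis vector, that is, to its own real
  coordinate at \<open>i\<close>: the defect in Bessel's inequality.\<close>

lemma vec_inner_coordinate_residual:
  fixes i :: nat and V :: "(nat \<Rightarrow> complex) set"
  defines "w \<equiv> \<lambda>j. (if j = i then 1 else 0) - (\<Sum>v\<in>V. cnj (v i) * v j)"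
  assumes "finite V" and on: "\<And>u v. u \<in> V \<Longrightarrow> v \<in> V \<Longrightarrow> vec_inner N u v = (if u = v then 1 else 0)"
    and "i < N"
  shows "v \<in> V \<Longrightarrow> vec_inner N w v = 0"
    and "vec_inner N w w = of_real (1 - (\<Sum>v\<in>V. (cmod (v i))\<^sup>2))"
proof -
  define e :: "nat \<Rightarrow> complex" where "e = (\<lambda>j. if j = i then 1 else 0)"
  have we: "w = (\<lambda>j. e j - (\<Sum>v\<in>V. cnj (v i) * v j))" by (simp add: w_def e_def)
  have ev: "vec_inner N e v = cnj (v i)" "vec_inner N v e = v i" for v
    using \<open>i < N\<close> by (simp_all add: vec_inner_def e_def if_distrib if_distribR cong: if_cong)
  have wv: "vec_inner N w v = 0" if "v \<in> V" for v
  proof -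
    have "(\<Sum>u\<in>V. cnj (u i) * vec_inner N u v) = (\<Sum>u\<in>V. if u = v then cnj (u i) else 0)"
      using that by (intro sum.cong refl) (auto simp: on)
    with that \<open>finite V\<close> show ?thesis by (simp add: we vec_inner_diff vec_inner_sum_left ev)
  qed
  then show "v \<in> V \<Longrightarrow> vec_inner N w v = 0" .
  have vw: "vec_inner N v w = 0" if "v \<in> V" for v
    using wv[OF that] cnj_vec_inner[of N w v] by simp
  have "vec_inner N w w = vec_inner N e w - (\<Sum>v\<in>V. cnj (v i) * vec_inner N v w)"
    by (subst we) (simp add: vec_inner_diff vec_inner_sum_left)
  also have "\<dots> = cnj (w i)" using vw by (simp add: ev)
  also have "w i = of_real (1 - (\<Sum>v\<in>V. (cmod (v i))\<^sup>2))"
    by (simp add: w_def complex_norm_square mult.commute del: of_real_power)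
  finally show "vec_inner N w w = of_real (1 - (\<Sum>v\<in>V. (cmod (v i))\<^sup>2))"
    by (metis complex_cnj_complex_of_real)
qed

text \<open>Bessel's inequality for each of the \<open>N\<close> basis vectors is summed; after
  exchanging the sums every unit vector in \<open>V\<close> contributes 1.\<close>

lemma card_orthonormal_le:
  assumes "finite V" and on: "\<And>u v. u \<in> V \<Longrightarrow> v \<in> V \<Longrightarrow> vec_inner N u v = (if u = v then 1 else 0)"
  shows "card V \<le> N"
proof -
  have "(\<Sum>v\<in>V. (cmod (v i))\<^sup>2) \<le> 1" if "i < N" for i
  proof -
    let ?w = "\<lambda>j. (if j = i then 1 else 0) - (\<Sum>v\<in>V. cnj (v i) * v j)"
    have "0 \<le> Re (vec_inner N ?w ?w)" by (rule vec_inner_self_nonneg)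
    also have "vec_inner N ?w ?w = of_real (1 - (\<Sum>v\<in>V. (cmod (v i))\<^sup>2))"
      by (rule vec_inner_coordinate_residual(2)[OF assms that])
    finally show ?thesis by simp
  qed
  then have "(\<Sum>i<N. \<Sum>v\<in>V. (cmod (v i))\<^sup>2) \<le> (\<Sum>i<N. 1)" by (intro sum_mono) auto
  moreover have "(\<Sum>i<N. \<Sum>v\<in>V. (cmod (v i))\<^sup>2) = (\<Sum>v\<in>V. \<Sum>i<N. (cmod (v i))\<^sup>2)"
    by (rule sum.swap)
  moreover have "(\<Sum>i<N. (cmod (v i))\<^sup>2) = 1" if "v \<in> V" for v
    using on[OF that that] unfolding vec_inner_self by (metis of_real_eq_1_iff)
  ultimately show ?thesis by simp
qed

text \<open>The orthogonal complement of con-eigenvectors is invariant, and its unit sphere is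
  compact, so the form attains a maximum there. The vector \<open>x\<close> only witnesses that the
  complement is nonzero.\<close>

lemma orthogonal_coneigenvector_exists:
  assumes sym: "\<And>i j. i < N \<Longrightarrow> j < N \<Longrightarrow> J i j = J j i"
    and eig: "\<And>v. v \<in> V \<Longrightarrow> \<exists>s :: real. conj_apply J N v = (\<lambda>i. of_real s * v i)"
    and x: "\<And>i. i \<ge> N \<Longrightarrow> x i = 0" "\<And>u. u \<in> V \<Longrightarrow> vec_inner N x u = 0" "vec_inner N x x \<noteq> 0"
  shows "\<exists>v. (\<forall>i\<ge>N. v i = 0) \<and> (\<forall>u\<in>V. vec_inner N v u = 0) \<and> vec_inner N v v = 1 \<and>
    (\<exists>s :: real. conj_apply J N v = (\<lambda>i. of_real s * v i))"
proof -
  define W where "W = {w. (\<forall>i\<ge>N. w i = 0) \<and> (\<forall>u\<in>V. vec_inner N w u = 0)}"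
  define S where "S = {w \<in> W. vec_inner N w w = 1}"
  \<comment> \<open>For a con-eigenvector \<open>u\<close> the exchange rule turns the inner product
    of \<open>conj_apply J N w\<close> and \<open>u\<close> into a multiple of that of
    \<open>u\<close> and \<open>w\<close>, which vanishes.\<close>
  have inv: "conj_apply J N w \<in> W" if w: "w \<in> W" for w
  proof -
    have "vec_inner N (conj_apply J N w) u = 0" if u: "u \<in> V" for u
    proof -
      obtain s :: real where s: "conj_apply J N u = (\<lambda>i. of_real s * u i)" using eig[OF u] by blast
      have "vec_inner N (conj_apply J N w) u = vec_inner N (conj_apply J N u) w"
        by (rule vec_inner_conj_apply_swap) (rule sym)
      also have "\<dots> = of_real s * vec_inner N u w" by (simp add: s vec_inner_scale)
      also have "vec_inner N u w = 0" using w u cnj_vec_inner[of N w u] by (simp add: W_def)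
      finally show ?thesis by simp
    qed
    then show ?thesis by (simp add: W_def conj_apply_def)
  qed
  \<comment> \<open>Compactness in the function space comes from Tychonoff's theorem: coordinates
    below \<open>N\<close> stay in the closed unit disc, all others are pinned to 0.\<close>
  define B :: "nat \<Rightarrow> complex set" where "B i = (if i < N then cball 0 1 else {0})" for i
  have "compactin (product_topology (\<lambda>i. euclidean) UNIV) (PiE UNIV B)"
    by (subst compactin_PiE) (auto simp: B_def)
  then have "compact (PiE UNIV B)" by (simp add: euclidean_product_topology)
  moreover have "closed S"
  proof -
    have cont: "continuous_on UNIV (\<lambda>w. vec_inner N w u)" for u
      unfolding vec_inner_def by (intro continuous_intros) auto
    have cont': "continuous_on UNIV (\<lambda>w. vec_inner N w w)"
      unfolding vec_inner_def by (intro continuous_intros) auto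
    have "S = (\<Inter>i\<in>{N..}. {w. w i = 0}) \<inter> (\<Inter>u\<in>V. {w. vec_inner N w u = 0}) \<inter> {w. vec_inner N w w = 1}"
      by (auto simp: S_def W_def)
    also have "closed \<dots>"
      by (intro closed_Int closed_INT ballI closed_Collect_eq cont cont' continuous_intros) auto
    finally show ?thesis .
  qed
  moreover have "S \<subseteq> PiE UNIV B"
  proof
    fix w assume w: "w \<in> S"
    have "cmod (w i) \<le> 1" if "i < N" for i
    proof -
      have "(\<Sum>i<N. (cmod (w i))\<^sup>2) = 1"
        using w unfolding S_def vec_inner_self mem_Collect_eq by (metis of_real_eq_1_iff)
      moreover have "(cmod (w i))\<^sup>2 \<le> (\<Sum>i<N. (cmod (w i))\<^sup>2)"
        using that by (intro member_le_sum) auto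
      ultimately show ?thesis by (simp add: power_le_one_iff abs_square_le_1)
    qed
    then show "w \<in> PiE UNIV B" using w by (auto simp: B_def S_def W_def)
  qed
  ultimately have "compact S" by (metis compact_Int_closed inf.absorb_iff2)
  moreover have "S \<noteq> {}"
  proof -
    obtain r :: real where "vec_inner N (\<lambda>i. of_real r * x i) (\<lambda>i. of_real r * x i) = 1"
      using vec_inner_normalize[OF x(3)] by blast
    then have "(\<lambda>i. of_real r * x i) \<in> S"
      using x(1,2) unfolding S_def W_def by (auto simp: vec_inner_scale(1))
    then show ?thesis by blast
  qed
  moreover have "continuous_on S (\<lambda>w. Re (vec_inner N (conj_apply J N w) w))"
  proof -
    have "continuous_on S (\<lambda>w. \<Sum>i<N. (\<Sum>j<N. J i j * cnj (w j)) * cnj (w i))"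
      by (intro continuous_intros continuous_on_subset[OF continuous_on_product_coordinates]) auto
    also have "(\<lambda>w. \<Sum>i<N. (\<Sum>j<N. J i j * cnj (w j)) * cnj (w i)) = (\<lambda>w. vec_inner N (conj_apply J N w) w)"
      by (simp add: vec_inner_def conj_apply_def)
    finally show ?thesis by (intro continuous_intros)
  qed
  ultimately obtain v where v: "v \<in> S"
    and max: "\<And>w. w \<in> S \<Longrightarrow> Re (vec_inner N (conj_apply J N w) w) \<le> Re (vec_inner N (conj_apply J N v) v)"
    using continuous_attains_sup[of S "\<lambda>w. Re (vec_inner N (conj_apply J N w) w)"] by blast
  have "\<exists>s :: real. conj_apply J N v = (\<lambda>i. of_real s * v i)"
    using v max by (intro coneigenvector_if_maximizes[OF sym inv[unfolded W_def]])
      (auto simp: S_def W_def)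
  then show ?thesis using v by (auto simp: S_def W_def)
qed

text \<open>Takagi's factorization as a completeness relation. An orthonormal set of
  con-eigenvectors of largest cardinality is complete, since a nonzero residual of a basis vector
  would provide one more con-eigenvector.\<close>

lemma coneigenvector_resolution_of_identity:
  assumes sym: "\<And>i j. i < N \<Longrightarrow> j < N \<Longrightarrow> J i j = J j i"
  shows "\<exists>V. finite V \<and>
    (\<forall>v\<in>V. \<exists>s :: real. conj_apply J N v = (\<lambda>i. of_real s * v i)) \<and>
    (\<forall>i<N. \<forall>j<N. (\<Sum>v\<in>V. cnj (v i) * v j) = (if i = j then 1 else 0))"
proof -
  define ok where "ok V \<longleftrightarrow> finite V \<and>
    (\<forall>u\<in>V. \<forall>v\<in>V. vec_inner N u v = (if u = v then 1 else 0)) \<and>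
    (\<forall>v\<in>V. (\<forall>i\<ge>N. v i = 0) \<and> (\<exists>s :: real. conj_apply J N v = (\<lambda>i. of_real s * v i)))" for V
  have "ok {}" by (simp add: ok_def)
  moreover have "card V \<le> N" if "ok V" for V
    using that by (intro card_orthonormal_le) (auto simp: ok_def)
  ultimately obtain V where V: "ok V" and max: "\<And>U. ok U \<Longrightarrow> card U \<le> card V"
    using ex_has_greatest_nat[of ok "{}" card "Suc N"] by (auto simp: less_Suc_eq_le)
  have fin: "finite V" and on: "\<And>u v. u \<in> V \<Longrightarrow> v \<in> V \<Longrightarrow> vec_inner N u v = (if u = v then 1 else 0)"
    and supp: "\<And>v i. v \<in> V \<Longrightarrow> i \<ge> N \<Longrightarrow> v i = 0"
    and eig: "\<And>v. v \<in> V \<Longrightarrow> \<exists>s :: real. conj_apply J N v = (\<lambda>i. of_real s * v i)"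
    using V by (auto simp: ok_def)
  have complete: "(\<Sum>v\<in>V. cnj (v i) * v j) = (if i = j then 1 else 0)" if ij: "i < N" "j < N" for i j
  proof -
    \<comment> \<open>The asserted identity says exactly that this residual vanishes at
      \<open>j\<close>.\<close>
    define w where "w = (\<lambda>j. (if j = i then 1 else 0) - (\<Sum>v\<in>V. cnj (v i) * v j))"
    have "vec_inner N w w = 0"
    proof (rule ccontr)
      assume "vec_inner N w w \<noteq> 0"
      moreover have "w k = 0" if "k \<ge> N" for k
        using that ij by (auto simp: w_def supp intro!: sum.neutral)
      moreover have "vec_inner N w u = 0" if "u \<in> V" for u
        unfolding w_def using vec_inner_coordinate_residual(1)[OF fin on ij(1) that] .
      ultimately have "\<exists>v. (\<forall>i\<ge>N. v i = 0) \<and> (\<forall>u\<in>V. vec_inner N v u = 0) \<and> vec_inner N v v = 1 \<and>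
          (\<exists>s :: real. conj_apply J N v = (\<lambda>i. of_real s * v i))"
        by (intro orthogonal_coneigenvector_exists[where x = w] sym eig)
      then obtain v where v: "\<forall>i\<ge>N. v i = 0" "\<forall>u\<in>V. vec_inner N v u = 0" "vec_inner N v v = 1"
        "\<exists>s :: real. conj_apply J N v = (\<lambda>i. of_real s * v i)"
        by blast
      then have uv: "\<forall>u\<in>V. vec_inner N u v = 0" by (metis cnj_vec_inner complex_cnj_zero)
      have "v \<notin> V" using v(2,3) by force
      moreover have "ok (insert v V)"
        using V v uv unfolding ok_def by (auto split: if_splits)
      ultimately show False using max[of "insert v V"] fin by simp
    qed
    then have "w j = 0" using ij(2) by (rule vec_inner_self_eq_0D)
    then show ?thesis by (auto simp: w_def)
  qed
  have eig': "\<forall>v\<in>V. \<exists>s :: real. conj_apply J N v = (\<lambda>i. of_real s * v i)"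
    using V unfolding ok_def by blast
  have complete': "\<forall>i<N. \<forall>j<N. (\<Sum>v\<in>V. cnj (v i) * v j) = (if i = j then 1 else 0)"
    by (intro allI impI) (rule complete)
  show ?thesis by (rule exI[of _ V]) (intro conjI fin eig' complete')
qed

section \<open>The recurrence and its quadrature\<close>

text \<open>The conditional encodes the convention \<open>p\<^sub>-\<^sub>1 = 0\<close>, since
  \<open>n - 1\<close> truncates at 0.\<close>

fun jacobi_poly :: "(nat \<Rightarrow> complex) \<Rightarrow> (nat \<Rightarrow> real) \<Rightarrow> nat \<Rightarrow> complex \<Rightarrow> complex" where
  "jacobi_poly \<alpha> \<beta> 0 z = 1"
| "jacobi_poly \<alpha> \<beta> (Suc n) z =
    (z * cnj (jacobi_poly \<alpha> \<beta> n z) - \<alpha> (Suc n) * jacobi_poly \<alpha> \<beta> n z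
      - (if n = 0 then 0 else of_real (\<beta> n) * jacobi_poly \<alpha> \<beta> (n - 1) z)) / of_real (\<beta> (Suc n))"

lemma jacobi_poly_recurrence:
  assumes "\<beta> (Suc n) \<noteq> 0"
  shows "z * cnj (jacobi_poly \<alpha> \<beta> n z) =
    of_real (\<beta> (Suc n)) * jacobi_poly \<alpha> \<beta> (Suc n) z + \<alpha> (Suc n) * jacobi_poly \<alpha> \<beta> n z +
    (if n = 0 then 0 else of_real (\<beta> n) * jacobi_poly \<alpha> \<beta> (n - 1) z)"
  using assms by (simp add: field_simps)

text \<open>Rows and columns start at 0, the parameters at 1, hence the shift in the diagonal. The
  matrix is complex symmetric, in general not Hermitian.\<close>

definition jacobi_matrix :: "(nat \<Rightarrow> complex) \<Rightarrow> (nat \<Rightarrow> real) \<Rightarrow> nat \<Rightarrow> nat \<Rightarrow> complex" where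
  "jacobi_matrix \<alpha> \<beta> i j =
    (if i = j then \<alpha> (Suc i) else if j = Suc i then of_real (\<beta> j)
     else if i = Suc j then of_real (\<beta> i) else 0)"

text \<open>Every row but the last of the truncation sees all three terms of the recurrence; in the
  last one the superdiagonal entry is cut off.\<close>

lemma jacobi_matrix_row_sum:
  assumes "Suc i < N"
  shows "(\<Sum>j<N. jacobi_matrix \<alpha> \<beta> i j * x j) =
    of_real (\<beta> (Suc i)) * x (Suc i) + \<alpha> (Suc i) * x i +
    (if i = 0 then 0 else of_real (\<beta> i) * x (i - 1))"
proof -
  \<comment> \<open>At \<open>i = 0\<close> the truncated index \<open>i - 1\<close> is again 0; the
    inner conditional removes the nonexistent subdiagonal entry.\<close>
  have "(\<Sum>j<N. jacobi_matrix \<alpha> \<beta> i j * x j) =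
      (\<Sum>j<N. (if j = Suc i then of_real (\<beta> (Suc i)) * x j else 0) +
        ((if j = i then \<alpha> (Suc i) * x j else 0) +
         (if j = i - 1 then (if i = 0 then 0 else of_real (\<beta> i) * x j) else 0)))"
    by (intro sum.cong refl) (auto simp: jacobi_matrix_def)
  also have "\<dots> = of_real (\<beta> (Suc i)) * x (Suc i) + (\<alpha> (Suc i) * x i +
      (if i = 0 then 0 else of_real (\<beta> i) * x (i - 1)))"
    using assms by (simp only: sum.distrib sum.delta finite_lessThan) simp
  finally show ?thesis by (simp add: add.assoc)
qed

text \<open>If \<open>v 0 = 0\<close>, the division yields the junk value \<open>0\<close>, and the identity still holds because the
  recurrence then forces \<open>v = 0\<close>.\<close>

lemma coneigenvector_coordinates:
  assumes \<beta>: "\<And>j. j \<ge> 1 \<Longrightarrow> \<beta> j \<noteq> 0"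
    and eig: "conj_apply (jacobi_matrix \<alpha> \<beta>) N v = (\<lambda>i. of_real s * v i)" and "i < N"
  shows "cnj (v i) = cnj (v 0) * jacobi_poly \<alpha> \<beta> i (of_real s * v 0 / cnj (v 0))"
  using \<open>i < N\<close>
proof (induction i rule: less_induct)
  case (less i)
  define l where "l = of_real s * v 0 / cnj (v 0)"
  show ?case
  proof (cases i)
    case (Suc n)
    \<comment> \<open>Row \<open>n\<close> of the equation determines \<open>v i\<close> from the
      two preceding coordinates; by \<open>i < N\<close> it is not the last row.\<close>
    have "of_real s * v n = conj_apply (jacobi_matrix \<alpha> \<beta>) N v n" by (simp add: eig)
    also have "\<dots> = of_real (\<beta> i) * cnj (v i) + \<alpha> i * cnj (v n) +
        (if n = 0 then 0 else of_real (\<beta> n) * cnj (v (n - 1)))"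
      using less.prems Suc by (simp add: conj_apply_def jacobi_matrix_row_sum)
    finally have 1: "of_real (\<beta> i) * cnj (v i) = of_real s * v n - \<alpha> i * cnj (v n) -
        (if n = 0 then 0 else of_real (\<beta> n) * cnj (v (n - 1)))" by simp
    have n: "cnj (v n) = cnj (v 0) * jacobi_poly \<alpha> \<beta> n l"
      using less.IH[of n] less.prems Suc by (simp add: l_def)
    have n': "cnj (v (n - 1)) = cnj (v 0) * jacobi_poly \<alpha> \<beta> (n - 1) l"
      using less.IH[of "n - 1"] less.prems Suc by (simp add: l_def)
    have "v n = v 0 * cnj (jacobi_poly \<alpha> \<beta> n l)"
      using arg_cong[OF n, of cnj] by simp
    \<comment> \<open>By the choice of \<open>l\<close>, \<open>of_real s * v 0\<close> equals
      \<open>cnj (v 0) * l\<close>, also for \<open>v 0 = 0\<close>, where both vanish.\<close>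
    then have 2: "of_real s * v n = cnj (v 0) * (l * cnj (jacobi_poly \<alpha> \<beta> n l))"
      by (simp add: l_def)
    have 3: "of_real (\<beta> i) * jacobi_poly \<alpha> \<beta> i l = l * cnj (jacobi_poly \<alpha> \<beta> n l)
        - \<alpha> i * jacobi_poly \<alpha> \<beta> n l - (if n = 0 then 0 else of_real (\<beta> n) * jacobi_poly \<alpha> \<beta> (n - 1) l)"
      using \<beta>[of "Suc n"] by (simp add: Suc jacobi_poly_recurrence del: jacobi_poly.simps)
    have "of_real (\<beta> i) * cnj (v i) = cnj (v 0) * (of_real (\<beta> i) * jacobi_poly \<alpha> \<beta> i l)"
      unfolding 1 2 3 n n' by (simp add: algebra_simps del: jacobi_poly.simps)
    then show ?thesis using \<beta>[of i] Suc by (simp add: l_def del: jacobi_poly.simps)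
  qed simp
qed

text \<open>The weight \<open>(cmod (v 0))\<^sup>2\<close> splits into \<open>cnj (v 0)\<close> and
  \<open>v 0\<close>, which turn the polynomial values at the node into coordinates of
  \<open>v\<close>; the completeness relation becomes discrete orthonormality. Nodes are indexed by
  vectors, so they may coincide.\<close>

lemma jacobi_quadrature:
  assumes \<beta>: "\<And>j. j \<ge> 1 \<Longrightarrow> \<beta> j \<noteq> 0"
  shows "\<exists>(V :: (nat \<Rightarrow> complex) set) w l. finite V \<and> (\<forall>v. 0 \<le> w v) \<and>
    (\<forall>i<N. \<forall>j<N. (\<Sum>v\<in>V. of_real (w v) * (jacobi_poly \<alpha> \<beta> i (l v) * cnj (jacobi_poly \<alpha> \<beta> j (l v))))
      = (if i = j then 1 else 0))"
proof -
  have "\<exists>V. finite V \<and>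
      (\<forall>v\<in>V. \<exists>s :: real. conj_apply (jacobi_matrix \<alpha> \<beta>) N v = (\<lambda>i. of_real s * v i)) \<and>
      (\<forall>i<N. \<forall>j<N. (\<Sum>v\<in>V. cnj (v i) * v j) = (if i = j then 1 else 0))"
    by (rule coneigenvector_resolution_of_identity) (auto simp: jacobi_matrix_def)
  then obtain V where V: "finite V"
    and eig: "\<forall>v\<in>V. \<exists>s :: real. conj_apply (jacobi_matrix \<alpha> \<beta>) N v = (\<lambda>i. of_real s * v i)"
    and id: "\<forall>i<N. \<forall>j<N. (\<Sum>v\<in>V. cnj (v i) * v j) = (if i = j then 1 else 0)"
    by (elim exE conjE)
  obtain s :: "(nat \<Rightarrow> complex) \<Rightarrow> real"
    where s: "\<And>v. v \<in> V \<Longrightarrow> conj_apply (jacobi_matrix \<alpha> \<beta>) N v = (\<lambda>i. of_real (s v) * v i)"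
    using bchoice[OF eig] by blast
  define w :: "(nat \<Rightarrow> complex) \<Rightarrow> real" where "w v = (cmod (v 0))\<^sup>2" for v
  define l where "l v = of_real (s v) * v 0 / cnj (v 0)" for v
  have "(\<Sum>v\<in>V. of_real (w v) * (jacobi_poly \<alpha> \<beta> i (l v) * cnj (jacobi_poly \<alpha> \<beta> j (l v))))
      = (if i = j then 1 else 0)" if "i < N" "j < N" for i j
  proof -
    have "of_real (w v) * (jacobi_poly \<alpha> \<beta> i (l v) * cnj (jacobi_poly \<alpha> \<beta> j (l v))) = cnj (v i) * v j"
      if v: "v \<in> V" for v
    proof -
      have "v j = v 0 * cnj (jacobi_poly \<alpha> \<beta> j (l v))"
        using arg_cong[OF coneigenvector_coordinates[OF \<beta> s[OF v] \<open>j < N\<close>], of cnj] by (simp add: l_def)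
      moreover have "cnj (v i) = cnj (v 0) * jacobi_poly \<alpha> \<beta> i (l v)"
        using coneigenvector_coordinates[OF \<beta> s[OF v] \<open>i < N\<close>] by (simp add: l_def)
      ultimately show ?thesis by (simp add: w_def complex_norm_square del: of_real_power)
    qed
    then show ?thesis using id that by simp
  qed
  then show ?thesis using V by (intro exI[of _ V] exI[of _ w] exI[of _ l]) (auto simp: w_def)
qed

section \<open>Spans of monomials and of Jacobi polynomials\<close>

lemma r2_monom_0 [simp]: "r2_monom 0 z = 1"
  by (simp add: r2_monom_def)

lemma norm_r2_monom: "norm (r2_monom n z) = norm z ^ n"
  by (cases n) (auto simp: r2_monom_def norm_mult norm_power)

lemma measurable_r2_monom [measurable]: "r2_monom n \<in> borel_measurable borel"
  unfolding r2_monom_def by (cases "even n") simp_all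

text \<open>Phases cancel or survive at most once, so every Gram entry of the monomials is a single
  moment or its conjugate.\<close>

lemma r2_monom_mult_cnj:
  "r2_monom i z * cnj (r2_monom j z) =
    (if odd j \<and> even i then cnj (r2_monom (i + j) z) else r2_monom (i + j) z)"
proof (cases "odd i \<and> odd j")
  case True
  then obtain a b where "i = Suc (2 * a)" "j = Suc (2 * b)" by (metis oddE Suc_eq_plus1)
  then show ?thesis
    using complex_norm_square[of z] by (simp add: r2_monom_def power_add power2_eq_square algebra_simps)
next
  case False
  then show ?thesis
    by (cases "odd i"; cases "odd j")
      (auto simp: r2_monom_def algebra_simps elim!: oddE simp flip: power_add of_real_mult)
qed

text \<open>Raising the degree of a monomial is the same antilinear operation that drives the
  recurrence.\<close>

lemma r2_monom_Suc: "r2_monom (Suc n) z = z * cnj (r2_monom n z)"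
  using r2_monom_mult_cnj[of 1 z n] by (auto simp: r2_monom_def split: if_splits)

text \<open>For a graded family \<open>B\<close> this is the space of degree below \<open>n\<close>;
  explicit coefficients allow inner products to be expanded.\<close>

definition lincombs :: "(nat \<Rightarrow> complex \<Rightarrow> complex) \<Rightarrow> nat \<Rightarrow> (complex \<Rightarrow> complex) set" where
  "lincombs B n = {f. \<exists>c. \<forall>z. f z = (\<Sum>k<n. c k * B k z)}"

lemma lincombsI: "(\<And>z. f z = (\<Sum>k<n. c k * B k z)) \<Longrightarrow> f \<in> lincombs B n"
  unfolding lincombs_def by blast

lemma lincombs_mono: "m \<le> n \<Longrightarrow> f \<in> lincombs B m \<Longrightarrow> f \<in> lincombs B n"
proof -
  assume "m \<le> n" "f \<in> lincombs B m"
  then obtain c where c: "\<And>z. f z = (\<Sum>k<m. c k * B k z)" by (auto simp: lincombs_def)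
  have "f z = (\<Sum>k<n. (if k < m then c k else 0) * B k z)" for z
    unfolding c using \<open>m \<le> n\<close> by (intro sum.mono_neutral_cong_left) auto
  then show ?thesis by (rule lincombsI)
qed

lemma lincombs_base: "k < n \<Longrightarrow> B k \<in> lincombs B n"
  by (rule lincombsI[where c = "\<lambda>j. if j = k then 1 else 0"])
    (simp add: if_distrib[of "\<lambda>x. x * _"] cong: if_cong)

lemma lincombs_scale: "f \<in> lincombs B n \<Longrightarrow> (\<lambda>z. c * f z) \<in> lincombs B n"
proof -
  assume "f \<in> lincombs B n"
  then obtain d where d: "\<And>z. f z = (\<Sum>k<n. d k * B k z)" by (auto simp: lincombs_def)
  have "c * f z = (\<Sum>k<n. (c * d k) * B k z)" for z by (simp add: d sum_distrib_left mult.assoc)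
  then show ?thesis by (rule lincombsI)
qed

lemma lincombs_add: "f \<in> lincombs B n \<Longrightarrow> g \<in> lincombs B n \<Longrightarrow> (\<lambda>z. f z + g z) \<in> lincombs B n"
proof -
  assume "f \<in> lincombs B n" "g \<in> lincombs B n"
  then obtain c d where "\<And>z. f z = (\<Sum>k<n. c k * B k z)" "\<And>z. g z = (\<Sum>k<n. d k * B k z)"
    by (auto simp: lincombs_def)
  then have "f z + g z = (\<Sum>k<n. (c k + d k) * B k z)" for z by (simp add: sum.distrib algebra_simps)
  then show ?thesis by (rule lincombsI)
qed

lemma lincombs_sum:
  "finite A \<Longrightarrow> (\<And>k. k \<in> A \<Longrightarrow> g k \<in> lincombs B n) \<Longrightarrow> (\<lambda>z. \<Sum>k\<in>A. c k * g k z) \<in> lincombs B n"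
proof (induction A rule: finite_induct)
  case empty
  show ?case unfolding lincombs_def by (intro CollectI exI[of _ "\<lambda>_. 0"]) simp
next
  case (insert a A)
  then show ?case by (simp add: lincombs_add lincombs_scale)
qed

text \<open>The operation is antilinear, so it suffices to check the spanning functions; the
  coefficients become conjugated.\<close>

lemma lincombs_mult_cnj:
  assumes "\<And>k. k < n \<Longrightarrow> (\<lambda>z. z * cnj (B k z)) \<in> lincombs B m" and f: "f \<in> lincombs B n"
  shows "(\<lambda>z. z * cnj (f z)) \<in> lincombs B m"
proof -
  obtain c where "\<And>z. f z = (\<Sum>k<n. c k * B k z)" using f by (auto simp: lincombs_def)
  then have "(\<lambda>z. z * cnj (f z)) = (\<lambda>z. \<Sum>k<n. cnj (c k) * (z * cnj (B k z)))"
    by (simp add: sum_distrib_left algebra_simps fun_eq_iff)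
  then show ?thesis using assms(1)
    by (simp only:) (rule lincombs_sum, auto)
qed

lemma jacobi_poly_mult_cnj:
  assumes "\<And>j. j \<ge> 1 \<Longrightarrow> \<beta> j \<noteq> 0"
  shows "(\<lambda>z. z * cnj (jacobi_poly \<alpha> \<beta> n z) - of_real (\<beta> (Suc n)) * jacobi_poly \<alpha> \<beta> (Suc n) z)
    \<in> lincombs (jacobi_poly \<alpha> \<beta>) (Suc n)"
proof -
  have "(\<lambda>z. \<alpha> (Suc n) * jacobi_poly \<alpha> \<beta> n z + (if n = 0 then 0 else of_real (\<beta> n)) * jacobi_poly \<alpha> \<beta> (n - 1) z)
    \<in> lincombs (jacobi_poly \<alpha> \<beta>) (Suc n)"
    by (intro lincombs_add lincombs_scale lincombs_base) auto
  also have "(\<lambda>z. \<alpha> (Suc n) * jacobi_poly \<alpha> \<beta> n z + (if n = 0 then 0 else of_real (\<beta> n)) * jacobi_poly \<alpha> \<beta> (n - 1) z)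
    = (\<lambda>z. z * cnj (jacobi_poly \<alpha> \<beta> n z) - of_real (\<beta> (Suc n)) * jacobi_poly \<alpha> \<beta> (Suc n) z)"
    using assms by (simp add: jacobi_poly_recurrence fun_eq_iff del: jacobi_poly.simps)
  finally show ?thesis .
qed

text \<open>Each application of the recurrence from degree \<open>n\<close> to \<open>Suc n\<close>
  contributes a factor \<open>\<beta> (Suc n)\<close> to the leading coefficient and only lower
  terms otherwise.\<close>

lemma r2_monom_leading:
  assumes "\<And>j. j \<ge> 1 \<Longrightarrow> \<beta> j \<noteq> 0"
  shows "(\<lambda>z. r2_monom n z - of_real (\<Prod>k\<in>{1..n}. \<beta> k) * jacobi_poly \<alpha> \<beta> n z)
    \<in> lincombs (jacobi_poly \<alpha> \<beta>) n"
proof (induction n)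
  case 0
  show ?case by (simp add: lincombs_def)
next
  case (Suc n)
  define D where "D = (\<Prod>k\<in>{1..n}. \<beta> k)"
  let ?P = "jacobi_poly \<alpha> \<beta>"
  have step: "(\<lambda>z. z * cnj (?P k z)) \<in> lincombs ?P (Suc n)" if "k < n" for k
  proof -
    have "(\<lambda>z. (z * cnj (?P k z) - of_real (\<beta> (Suc k)) * ?P (Suc k) z) + of_real (\<beta> (Suc k)) * ?P (Suc k) z)
        \<in> lincombs ?P (Suc n)"
      using that
      by (intro lincombs_add lincombs_scale lincombs_base lincombs_mono[OF _ jacobi_poly_mult_cnj] assms) auto
    then show ?thesis by (simp del: jacobi_poly.simps)
  qed
  have "(\<lambda>z. z * cnj (r2_monom n z - of_real D * ?P n z)) \<in> lincombs ?P (Suc n)"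
    using step Suc.IH unfolding D_def by (rule lincombs_mult_cnj)
  \<comment> \<open>The number \<open>D\<close> is real, so conjugation leaves the leading
    coefficient unchanged.\<close>
  from lincombs_add[OF this lincombs_scale[OF jacobi_poly_mult_cnj[of \<beta> \<alpha> n, OF assms], of "of_real D"]]
  have "(\<lambda>z. z * cnj (r2_monom n z - of_real D * ?P n z) +
      of_real D * (z * cnj (?P n z) - of_real (\<beta> (Suc n)) * ?P (Suc n) z)) \<in> lincombs ?P (Suc n)"
    by simp
  also have "(\<lambda>z. z * cnj (r2_monom n z - of_real D * ?P n z) +
      of_real D * (z * cnj (?P n z) - of_real (\<beta> (Suc n)) * ?P (Suc n) z)) =
      (\<lambda>z. r2_monom (Suc n) z - of_real (\<Prod>k\<in>{1..Suc n}. \<beta> k) * ?P (Suc n) z)"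
    by (simp add: D_def r2_monom_Suc algebra_simps del: jacobi_poly.simps)
  finally show ?case .
qed

lemma r2_monom_in_lincombs:
  assumes "\<And>j. j \<ge> 1 \<Longrightarrow> \<beta> j \<noteq> 0"
  shows "r2_monom n \<in> lincombs (jacobi_poly \<alpha> \<beta>) (Suc n)"
proof -
  have "(\<lambda>z. (r2_monom n z - of_real (\<Prod>k\<in>{1..n}. \<beta> k) * jacobi_poly \<alpha> \<beta> n z) +
      of_real (\<Prod>k\<in>{1..n}. \<beta> k) * jacobi_poly \<alpha> \<beta> n z) \<in> lincombs (jacobi_poly \<alpha> \<beta>) (Suc n)"
    by (intro lincombs_add lincombs_scale lincombs_base lincombs_mono[OF _ r2_monom_leading] assms) auto
  then show ?thesis by simp
qed

text \<open>The converse triangular relation, through which limits of monomial inner products carry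
  over to the polynomials.\<close>

lemma jacobi_poly_in_lincombs: "jacobi_poly \<alpha> \<beta> n \<in> lincombs r2_monom (Suc n)"
proof (induction n rule: less_induct)
  case (less n)
  show ?case
  proof (cases n)
    case 0
    have "jacobi_poly \<alpha> \<beta> n = r2_monom 0" by (auto simp: 0)
    then show ?thesis using lincombs_base[of 0 "Suc n" r2_monom] by (simp only:)
  next
    case (Suc m)
    let ?P = "jacobi_poly \<alpha> \<beta>"
    have "(\<lambda>z. inverse (of_real (\<beta> n)) * (z * cnj (?P m z)) + ((- \<alpha> n / of_real (\<beta> n)) * ?P m z +
        (if m = 0 then 0 else - of_real (\<beta> m) / of_real (\<beta> n)) * ?P (m - 1) z)) \<in> lincombs r2_monom (Suc n)"
    proof (intro lincombs_add lincombs_scale)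
      show "?P m \<in> lincombs r2_monom (Suc n)" "?P (m - 1) \<in> lincombs r2_monom (Suc n)"
        using Suc by (auto intro!: lincombs_mono[OF _ less.IH])
      show "(\<lambda>z. z * cnj (?P m z)) \<in> lincombs r2_monom (Suc n)"
      proof (rule lincombs_mult_cnj)
        show "?P m \<in> lincombs r2_monom n" using less.IH[of m] Suc by simp
        show "(\<lambda>z. z * cnj (r2_monom k z)) \<in> lincombs r2_monom (Suc n)" if "k < n" for k
          using lincombs_base[of "Suc k" "Suc n" r2_monom] that by (simp add: r2_monom_Suc[abs_def])
      qed
    qed
    also have "(\<lambda>z. inverse (of_real (\<beta> n)) * (z * cnj (?P m z)) + ((- \<alpha> n / of_real (\<beta> n)) * ?P m z +
        (if m = 0 then 0 else - of_real (\<beta> m) / of_real (\<beta> n)) * ?P (m - 1) z)) = ?P n"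
    proof
      fix z
      have "?P n z = (z * cnj (?P m z) - \<alpha> n * ?P m z
          - (if m = 0 then 0 else of_real (\<beta> m) * ?P (m - 1) z)) / of_real (\<beta> n)"
        by (simp add: Suc)
      then show "inverse (of_real (\<beta> n)) * (z * cnj (?P m z)) + ((- \<alpha> n / of_real (\<beta> n)) * ?P m z +
        (if m = 0 then 0 else - of_real (\<beta> m) / of_real (\<beta> n)) * ?P (m - 1) z) = ?P n z"
        by (cases "m = 0") (simp_all add: divide_inverse algebra_simps)
    qed
    finally show ?thesis .
  qed
qed

section \<open>Weak limits of discrete measures with bounded densities\<close>

text \<open>Indicators of closed sets are limits of continuous functions with values in [0,1], so
  the inequality passes to closed sets, and by inner regularity to all Borel sets.\<close>

lemma measure_le_if_integral_continuous_le:
  fixes M N :: "'a :: polish_space measure"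
  assumes "finite_measure M" "finite_measure N"
    and sets: "sets M = sets borel" "sets N = sets borel" and "0 \<le> c"
    and le: "\<And>f :: 'a \<Rightarrow> real. continuous_on UNIV f \<Longrightarrow> (\<And>x. 0 \<le> f x) \<Longrightarrow> (\<And>x. f x \<le> 1) \<Longrightarrow>
      (LINT x|M. f x) \<le> c * (LINT x|N. f x)"
    and A: "A \<in> sets borel"
  shows "measure M A \<le> c * measure N A"
proof -
  interpret M: finite_measure M by fact
  interpret N: finite_measure N by fact
  note [measurable_cong] = sets
  \<comment> \<open>The empty set is left out because the distance to it is 0 by convention.\<close>
  have closed: "measure M K \<le> c * measure N K" if K: "closed K" "K \<noteq> {}" for K
  proof -
    have [measurable]: "K \<in> sets borel" using K by auto
    define f :: "nat \<Rightarrow> 'a \<Rightarrow> real" where "f n x = max 0 (1 - real n * infdist x K)" for n x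
    have cont: "continuous_on UNIV (f n)" for n
      unfolding f_def by (intro continuous_intros)
    have [measurable]: "f n \<in> borel_measurable borel" for n
      using cont by (rule borel_measurable_continuous_onI)
    have bound: "0 \<le> f n x" "f n x \<le> 1" for n x by (auto simp: f_def infdist_nonneg)
    have lim: "(\<lambda>n. f n x) \<longlonglongrightarrow> indicator K x" for x
    proof (cases "x \<in> K")
      case True
      then show ?thesis by (simp add: f_def)
    next
      case False
      then have pos: "infdist x K > 0"
        using K in_closed_iff_infdist_zero[of K x] infdist_nonneg[of x K] by fastforce
      obtain n0 :: nat where n0: "1 / infdist x K < real n0" using reals_Archimedean2 by blast
      have "f n x = 0" if "n \<ge> n0" for n
      proof -
        have "1 / infdist x K \<le> real n" using n0 that by linarith
        then show ?thesis using pos by (simp add: f_def field_simps)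
      qed
      then show ?thesis using False
        by (auto intro!: tendsto_eventually eventually_sequentiallyI[of n0])
    qed
    have "(\<lambda>n. LINT x|M. f n x) \<longlonglongrightarrow> (LINT x|M. indicator K x)"
      by (rule integral_dominated_convergence[where w = "\<lambda>_. 1"]) (use lim bound in auto)
    moreover have "(\<lambda>n. LINT x|N. f n x) \<longlonglongrightarrow> (LINT x|N. indicator K x)"
      by (rule integral_dominated_convergence[where w = "\<lambda>_. 1"]) (use lim bound in auto)
    ultimately have "(LINT x|M. indicator K x) \<le> c * (LINT x|N. indicator K x :: real)"
      by (intro LIMSEQ_le[OF _ tendsto_mult_left]) (auto intro!: le cont bound)
    moreover have "space M = UNIV" "space N = UNIV" using sets[THEN sets_eq_imp_space_eq] by auto
    ultimately show ?thesis by simp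
  qed
  have "emeasure M A = (SUP K \<in> {K. K \<subseteq> A \<and> compact K}. emeasure M K)"
    using sets A by (intro inner_regular) auto
  also have "\<dots> \<le> ennreal (c * measure N A)"
  proof (rule SUP_least)
    fix K assume K: "K \<in> {K. K \<subseteq> A \<and> compact K}"
    have "measure M K \<le> c * measure N A"
    proof (cases "K = {}")
      case False
      then have "measure M K \<le> c * measure N K" using K by (intro closed compact_imp_closed) auto
      also have "\<dots> \<le> c * measure N A"
        using K A sets \<open>0 \<le> c\<close> by (intro mult_left_mono N.finite_measure_mono) auto
      finally show ?thesis .
    qed (use \<open>0 \<le> c\<close> in auto)
    then show "emeasure M K \<le> ennreal (c * measure N A)"
      by (simp add: M.emeasure_eq_measure ennreal_leI)
  qed
  finally show ?thesis
    using \<open>0 \<le> c\<close> by (simp add: M.emeasure_eq_measure)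
qed

text \<open>The measure with the negative part of \<open>k\<close> as density is dominated by the
  one with the positive part, first on test functions, then on Borel sets. On the set where
  \<open>k\<close> is negative the latter has no mass.\<close>

lemma AE_nonneg_if_integral_continuous_nonneg:
  fixes M :: "'a :: polish_space measure" and k :: "'a \<Rightarrow> real"
  assumes sets: "sets M = sets borel" and k: "integrable M k"
    and nonneg: "\<And>f :: 'a \<Rightarrow> real. continuous_on UNIV f \<Longrightarrow> (\<And>x. 0 \<le> f x) \<Longrightarrow> (\<And>x. f x \<le> 1) \<Longrightarrow>
      0 \<le> (LINT x|M. f x * k x)"
  shows "AE x in M. 0 \<le> k x"
proof -
  note [measurable_cong] = sets
  have [measurable]: "k \<in> borel_measurable M" using k by auto
  define kp kn where "kp x = max 0 (k x)" and "kn x = max 0 (- k x)" for x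
  have [measurable]: "kp \<in> borel_measurable M" "kn \<in> borel_measurable M"
    unfolding kp_def kn_def by simp_all
  have int: "integrable M kp" "integrable M kn"
    unfolding kp_def kn_def
    by (intro Bochner_Integration.integrable_max Bochner_Integration.integrable_minus integrable_zero k)+
  have pos: "0 \<le> kp x" "0 \<le> kn x" for x by (auto simp: kp_def kn_def)
  have "(LINT x|density M kn. f x) \<le> 1 * (LINT x|density M kp. f x)"
    if f: "continuous_on UNIV f" "\<And>x. 0 \<le> f x" "\<And>x. f x \<le> 1" for f :: "'a \<Rightarrow> real"
  proof -
    have fm[measurable]: "f \<in> borel_measurable borel" using f(1) by (rule borel_measurable_continuous_onI)
    have bdd: "integrable M (\<lambda>x. h x * f x)" if "integrable M h" for h
      by (rule Bochner_Integration.integrable_bound[OF that])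
        (use that f in \<open>auto simp: abs_mult mult_left_le\<close>)
    have "(LINT x|M. kp x * f x) - (LINT x|M. kn x * f x) = (LINT x|M. f x * k x)"
    proof -
      have "kp x * f x - kn x * f x = f x * k x" for x by (auto simp: kp_def kn_def max_def)
      then show ?thesis
        using Bochner_Integration.integral_diff[OF bdd[OF int(1)] bdd[OF int(2)]] by simp
    qed
    with nonneg[OF f] show ?thesis
      using pos by (simp add: integral_density)
  qed
  note density_le = this
  have fin: "finite_measure (density M (\<lambda>x. ennreal (g x)))" if "integrable M g" "\<And>x. 0 \<le> g x" for g
    using that by (intro finite_measureI)
      (simp add: emeasure_density nn_integral_eq_integral cong: nn_integral_cong)
  define A where "A = {x \<in> space M. k x < 0}"
  have A[measurable]: "A \<in> sets M" unfolding A_def by measurable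
  have meas: "measure (density M (\<lambda>x. ennreal (g x))) A = (LINT x|M. g x * indicator A x)"
    if "integrable M g" "\<And>x. 0 \<le> g x" for g
  proof -
    have "measure (density M (\<lambda>x. ennreal (g x))) A = (LINT x|density M (\<lambda>x. ennreal (g x)). indicator A x)"
      using A sets.sets_into_space[OF A] by (simp add: Int_absorb2)
    also have "\<dots> = (LINT x|M. g x * indicator A x)"
      using that by (subst integral_density) auto
    finally show ?thesis .
  qed
  have "measure (density M kn) A \<le> 1 * measure (density M kp) A"
    using A sets by (intro measure_le_if_integral_continuous_le density_le fin int pos) auto
  also have "measure (density M kp) A = (LINT x|M. 0)"
    unfolding meas[OF int(1) pos(1)]
    by (intro Bochner_Integration.integral_cong) (auto simp: kp_def A_def indicator_def)
  finally have "(LINT x|M. kn x * indicator A x) \<le> 0"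
    by (simp add: meas int pos)
  moreover have "0 \<le> (LINT x|M. kn x * indicator A x)" using pos by (intro integral_nonneg_AE) auto
  ultimately have "(LINT x|M. kn x * indicator A x) = 0" by simp
  moreover have "integrable M (\<lambda>x. kn x * indicator A x)"
    by (intro integrable_real_mult_indicator A int)
  ultimately have "AE x in M. kn x * indicator A x = 0"
    using pos by (subst (asm) integral_nonneg_eq_0_iff_AE) auto
  then show ?thesis
    by (rule AE_mp) (auto intro!: AE_I2 simp: kn_def A_def indicator_def split: if_splits)
qed

section \<open>Weak limits of discrete distributions and their moments\<close>

text \<open>Bounded second moments make \<open>f\<close> uniformly integrable: clamping it at level
  \<open>T\<close> changes each integral by at most \<open>C / T\<close>, and clamped functions are
  covered by weak convergence.\<close>

lemma weak_conv_integral_square_bounded: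
  fixes f :: "real \<Rightarrow> real"
  assumes \<mu>: "\<And>n. real_distribution (\<mu> n)" "real_distribution M" "weak_conv_m \<mu> M"
    and f: "continuous_on UNIV f"
    and int: "\<And>n. integrable (\<mu> n) f" "\<And>n. integrable (\<mu> n) (\<lambda>x. (f x)\<^sup>2)"
    and le: "\<And>n. (LINT x|\<mu> n. (f x)\<^sup>2) \<le> C"
  shows "integrable M f" "(\<lambda>n. LINT x|\<mu> n. f x) \<longlonglongrightarrow> (LINT x|M. f x)"
proof -
  interpret \<mu>: real_distribution "\<mu> n" for n by fact
  interpret M: real_distribution M by fact
  have [measurable]: "f \<in> borel_measurable borel" using f by (rule borel_measurable_continuous_onI)
  have isCont: "isCont f x" for x using f by (simp add: continuous_on_eq_continuous_at)
  have "0 \<le> (LINT x|\<mu> 0. (f x)\<^sup>2)" by simp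
  then have C: "0 \<le> C" using le[of 0] by linarith
  \<comment> \<open>Truncated squares are bounded and continuous, so their integrals keep the bound
    \<open>C\<close> in the limit; Fatou's lemma then gives it for the full square.\<close>
  define h where "h k x = min ((f x)\<^sup>2) (real k)" for k x
  have [measurable]: "h k \<in> borel_measurable borel" for k unfolding h_def by measurable
  have h_bound: "norm (h k x) \<le> real k" for k x by (auto simp: h_def)
  have h_le: "(LINT x|M. h k x) \<le> C" for k
  proof (rule LIMSEQ_le_const2)
    show "(\<lambda>n. LINT x|\<mu> n. h k x) \<longlonglongrightarrow> (LINT x|M. h k x)"
      by (rule weak_conv_imp_integral_bdd_continuous_conv[OF \<mu> _ h_bound])
        (auto simp: h_def intro!: continuous_intros isCont)
    have "(LINT x|\<mu> n. h k x) \<le> C" for n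
    proof -
      have "(LINT x|\<mu> n. h k x) \<le> (LINT x|\<mu> n. (f x)\<^sup>2)"
        by (intro integral_mono int \<mu>.integrable_const_bound[where B = "real k"]) (use h_bound in \<open>auto simp: h_def\<close>)
      with le[of n] show ?thesis by linarith
    qed
    then show "\<exists>N. \<forall>n\<ge>N. (LINT x|\<mu> n. h k x) \<le> C" by blast
  qed
  have nn: "(\<integral>\<^sup>+x. ennreal ((f x)\<^sup>2) \<partial>M) \<le> ennreal C"
  proof -
    have "(\<lambda>k. ennreal (h k x)) \<longlonglongrightarrow> ennreal ((f x)\<^sup>2)" for x
    proof -
      obtain n0 :: nat where n0: "(f x)\<^sup>2 < real n0" using reals_Archimedean2 by blast
      have "h n x = (f x)\<^sup>2" if "n \<ge> n0" for n using n0 that by (simp add: h_def min_def)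
      then show ?thesis by (auto intro!: tendsto_eventually eventually_sequentiallyI[of n0])
    qed
    then have "(\<integral>\<^sup>+x. ennreal ((f x)\<^sup>2) \<partial>M) = (\<integral>\<^sup>+x. liminf (\<lambda>k. ennreal (h k x)) \<partial>M)"
      by (intro nn_integral_cong) (metis lim_imp_Liminf sequentially_bot)
    also have "\<dots> \<le> liminf (\<lambda>k. \<integral>\<^sup>+x. ennreal (h k x) \<partial>M)"
      by (intro nn_integral_liminf) auto
    also have "\<dots> \<le> ennreal C"
    proof (rule Liminf_le)
      show "\<forall>\<^sub>F k in sequentially. (\<integral>\<^sup>+x. ennreal (h k x) \<partial>M) \<le> ennreal C"
      proof (intro always_eventually allI)
        fix k
        have "integrable M (h k)"
          by (rule M.integrable_const_bound[where B = "real k"]) (use h_bound in auto)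
        then have "(\<integral>\<^sup>+x. ennreal (h k x) \<partial>M) = ennreal (LINT x|M. h k x)"
          by (rule nn_integral_eq_integral) (simp add: h_def)
        then show "(\<integral>\<^sup>+x. ennreal (h k x) \<partial>M) \<le> ennreal C" using h_le by (simp add: ennreal_leI)
      qed
    qed simp
    finally show ?thesis .
  qed
  have sq: "integrable M (\<lambda>x. (f x)\<^sup>2)"
    using nn by (intro integrableI_bounded) (auto simp: less_top[symmetric] top_unique)
  have sq_le: "(LINT x|M. (f x)\<^sup>2) \<le> C"
    using nn C by (simp add: nn_integral_eq_integral[OF sq])
  have abs_le: "\<bar>y\<bar> \<le> 1 + y\<^sup>2" for y :: real
    using sum_squares_bound[of "\<bar>y\<bar>" 1] by (simp add: power2_eq_square)
  show fM: "integrable M f"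
    by (rule Bochner_Integration.integrable_bound[where f = "\<lambda>x. 1 + (f x)\<^sup>2"]) (use sq abs_le in auto)
  have clamp: "\<bar>(LINT x|N. f x) - (LINT x|N. max (- T) (min T (f x)))\<bar> \<le> C / T"
    if "real_distribution N" "integrable N f" "integrable N (\<lambda>x. (f x)\<^sup>2)" "(LINT x|N. (f x)\<^sup>2) \<le> C" "T > 0" for N T
  proof -
    interpret N: real_distribution N by fact
    have g: "integrable N (\<lambda>x. max (- T) (min T (f x)))"
      by (rule N.integrable_const_bound[where B = T]) (use \<open>T > 0\<close> in auto)
    \<comment> \<open>Clamping changes only values above \<open>T\<close> in modulus, and there
      \<open>\<bar>y\<bar>\<close> is at most \<open>y\<^sup>2 / T\<close>.\<close>
    have pt: "\<bar>y - max (- T) (min T y)\<bar> \<le> y\<^sup>2 / T" for y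
    proof (cases "\<bar>y\<bar> \<le> T")
      case True
      then show ?thesis using \<open>T > 0\<close> by (auto simp: max_def min_def)
    next
      case False
      then have "\<bar>y - max (- T) (min T y)\<bar> \<le> \<bar>y\<bar>" using \<open>T > 0\<close> by (auto simp: max_def min_def)
      also have "\<dots> \<le> y\<^sup>2 / T"
        using False \<open>T > 0\<close> mult_right_mono[of T "\<bar>y\<bar>" "\<bar>y\<bar>"]
        by (simp add: pos_le_divide_eq power2_eq_square mult.commute)
      finally show ?thesis .
    qed
    have "\<bar>(LINT x|N. f x) - (LINT x|N. max (- T) (min T (f x)))\<bar> = \<bar>LINT x|N. f x - max (- T) (min T (f x))\<bar>"
      using that g by simp
    also have "\<dots> \<le> (LINT x|N. (f x)\<^sup>2 / T)"
      by (rule integral_abs_bound_integral) (use that g pt in auto)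
    also have "\<dots> \<le> C / T" using that by (simp add: divide_right_mono)
    finally show ?thesis .
  qed
  show "(\<lambda>n. LINT x|\<mu> n. f x) \<longlonglongrightarrow> (LINT x|M. f x)"
  proof (rule LIMSEQ_I)
    fix e :: real assume e: "e > 0"
    \<comment> \<open>This makes both clamping errors smaller than \<open>e / 3\<close>; the summand
      1 keeps \<open>T\<close> positive when \<open>C = 0\<close>.\<close>
    define T where "T = 3 * C / e + 1"
    have T: "T > 0" "C / T < e / 3"
      using C e by (auto simp: T_def field_simps intro!: add_nonneg_pos)
    let ?g = "\<lambda>x. max (- T) (min T (f x))"
    have "(\<lambda>n. LINT x|\<mu> n. ?g x) \<longlonglongrightarrow> (LINT x|M. ?g x)"
      by (rule weak_conv_imp_integral_bdd_continuous_conv[OF \<mu>, where B = T])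
        (use T in \<open>auto intro!: continuous_intros isCont\<close>)
    then obtain n0 where n0: "\<And>n. n \<ge> n0 \<Longrightarrow> \<bar>(LINT x|\<mu> n. ?g x) - (LINT x|M. ?g x)\<bar> < e / 3"
      using e by (metis LIMSEQ_D real_norm_def zero_less_divide_iff zero_less_numeral)
    have "norm ((LINT x|\<mu> n. f x) - (LINT x|M. f x)) < e" if "n \<ge> n0" for n
      using n0[OF that] clamp[OF \<mu>(1) int le T(1), of n] clamp[OF \<mu>(2) fM sq sq_le T(1)] T(2)
      unfolding real_norm_def by linarith
    then show "\<exists>n0. \<forall>n\<ge>n0. norm ((LINT x|\<mu> n. f x) - (LINT x|M. f x)) < e" by blast
  qed
qed

text \<open>As a push-forward, it adds the weights of indices that share a position.\<close>

definition discrete_dist :: "'i set \<Rightarrow> ('i \<Rightarrow> real) \<Rightarrow> ('i \<Rightarrow> real) \<Rightarrow> real measure" where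
  "discrete_dist I w x = distr (point_measure I (\<lambda>i. ennreal (w i))) borel x"

lemma discrete_dist:
  assumes "finite I" "\<And>i. i \<in> I \<Longrightarrow> 0 \<le> w i"
  shows real_distribution_discrete_dist: "sum w I = 1 \<Longrightarrow> real_distribution (discrete_dist I w x)"
    and integral_discrete_dist:
      "\<And>f :: real \<Rightarrow> real. f \<in> borel_measurable borel \<Longrightarrow> (LINT y|discrete_dist I w x. f y) = (\<Sum>i\<in>I. w i * f (x i))"
    and integrable_discrete_dist:
      "\<And>f :: real \<Rightarrow> real. f \<in> borel_measurable borel \<Longrightarrow> integrable (discrete_dist I w x) f"
proof -
  show "real_distribution (discrete_dist I w x)" if "sum w I = 1"
  proof -
    have "emeasure (point_measure I (\<lambda>i. ennreal (w i))) I = 1"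
      using assms that by (simp add: emeasure_point_measure_finite sum_ennreal)
    then have "prob_space (point_measure I (\<lambda>i. ennreal (w i)))"
      by (intro prob_spaceI) (simp add: space_point_measure)
    then show ?thesis unfolding discrete_dist_def
      by (rule prob_space.real_distribution_distr) simp
  qed
  fix f :: "real \<Rightarrow> real" assume f: "f \<in> borel_measurable borel"
  show "(LINT y|discrete_dist I w x. f y) = (\<Sum>i\<in>I. w i * f (x i))"
    unfolding discrete_dist_def using assms f
    by (subst integral_distr) (simp_all add: lebesgue_integral_point_measure_finite)
  show "integrable (discrete_dist I w x) f"
    unfolding discrete_dist_def using assms f
    by (subst integrable_distr_eq) (simp_all add: integrable_point_measure_finite)
qed

text \<open>Bounded second moments give tightness by Chebyshev's inequality, hence a weak limit.
  Moments of order \<open>m\<close> converge because those of order \<open>2 * m\<close> are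
  bounded. The given subsequence \<open>s\<close> permits repeated extraction.\<close>

lemma discrete_dist_convergent_subseq:
  fixes w x :: "nat \<Rightarrow> 'i \<Rightarrow> real"
  assumes I: "\<And>n. finite (I n)" and w0: "\<And>n. \<forall>i\<in>I n. 0 \<le> w n i" and w1: "\<And>n. sum (w n) (I n) = 1"
    and C: "\<And>m n. (\<Sum>i\<in>I n. w n i * x n i ^ (2 * m)) \<le> C m"
    and s: "strict_mono s"
  shows "\<exists>r M. strict_mono (r :: nat \<Rightarrow> nat) \<and> real_distribution M \<and>
    (\<forall>f :: real \<Rightarrow> real. continuous_on UNIV f \<longrightarrow> bounded (range f) \<longrightarrow>
      (\<lambda>n. \<Sum>i\<in>I (s (r n)). w (s (r n)) i * f (x (s (r n)) i)) \<longlonglongrightarrow> (LINT y|M. f y)) \<and>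
    (\<forall>m. integrable M (\<lambda>y. y ^ m) \<and>
      (\<lambda>n. \<Sum>i\<in>I (s (r n)). w (s (r n)) i * x (s (r n)) i ^ m) \<longlonglongrightarrow> (LINT y|M. y ^ m))"
proof -
  have w: "\<And>n i. i \<in> I n \<Longrightarrow> 0 \<le> w n i" "\<And>n. sum (w n) (I n) = 1" using w0 w1 by auto
  define \<mu> where "\<mu> n = discrete_dist (I n) (w n) (x n)" for n
  have rd: "real_distribution (\<mu> n)" for n
    unfolding \<mu>_def by (rule real_distribution_discrete_dist[OF I w])
  have int: "integrable (\<mu> n) f" if "f \<in> borel_measurable borel" for f :: "real \<Rightarrow> real" and n
    unfolding \<mu>_def by (rule integrable_discrete_dist[OF I w(1) that])
  have integral: "(LINT y|\<mu> n. f y) = (\<Sum>i\<in>I n. w n i * f (x n i))" if "f \<in> borel_measurable borel" for f n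
    unfolding \<mu>_def by (rule integral_discrete_dist[OF I w(1) that])
  have "tight \<mu>"
    unfolding tight_def
  proof (intro conjI allI impI rd)
    fix e :: real assume e: "e > 0"
    define c where "c = max 0 (C 1)"
    \<comment> \<open>Chosen so that Chebyshev's bound \<open>c / a\<^sup>2\<close> falls below
      \<open>e\<close>; the summand 1 secures \<open>a \<ge> 1\<close>.\<close>
    define a where "a = c / e + 1"
    have c: "c \<ge> 0" "C 1 \<le> c" by (auto simp: c_def)
    have a: "a \<ge> 1" using c e by (simp add: a_def)
    have "c < e * a" using e by (simp add: a_def field_simps)
    also have "\<dots> \<le> e * a\<^sup>2" using a e by (simp add: power2_eq_square)
    finally have ca: "c / a\<^sup>2 < e" using a by (simp add: field_simps)
    have "measure (\<mu> n) {- a<..a} > 1 - e" for n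
    proof -
      interpret real_distribution "\<mu> n" by (rule rd)
      have "1 - measure (\<mu> n) {- a<..a} = (LINT y|\<mu> n. 1 - indicator {- a<..a} y)"
        by (subst Bochner_Integration.integral_diff) (auto simp: prob_space[unfolded space_eq_univ] intro!: int)
      also have "\<dots> \<le> (LINT y|\<mu> n. y ^ 2 / a\<^sup>2)"
      proof (intro integral_mono int)
        fix y :: real
        show "1 - indicator {- a<..a} y \<le> y ^ 2 / a\<^sup>2"
          using a by (auto simp: indicator_def divide_simps abs_le_square_iff[symmetric])
      qed measurable
      also have "\<dots> = (LINT y|\<mu> n. y ^ 2) / a\<^sup>2" by simp
      also have "\<dots> = (\<Sum>i\<in>I n. w n i * x n i ^ (2 * 1)) / a\<^sup>2" by (subst integral) auto
      also have "\<dots> \<le> c / a\<^sup>2" using order_trans[OF C c(2)] by (intro divide_right_mono) auto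
      finally show ?thesis using ca by simp
    qed
    then show "\<exists>a b. a < b \<and> (\<forall>n. 1 - e < measure (\<mu> n) {a<..b})"
      using a by (intro exI[of _ "- a"] exI[of _ a]) auto
  qed
  then obtain r M where r: "strict_mono r" "real_distribution M" and conv: "weak_conv_m (\<mu> \<circ> s \<circ> r) M"
    using tight_imp_convergent_subsubsequence s by blast
  note conv' = rd r(2) conv[unfolded comp_def]
  show ?thesis
  proof (intro exI[of _ r] exI[of _ M] conjI allI impI r)
    fix f :: "real \<Rightarrow> real" assume f: "continuous_on UNIV f" "bounded (range f)"
    then have [measurable]: "f \<in> borel_measurable borel" by (intro borel_measurable_continuous_onI)
    obtain B where "\<And>y. norm (f y) \<le> B" using f(2) by (auto simp: bounded_iff)
    then have "(\<lambda>n. LINT y|\<mu> (s (r n)). f y) \<longlonglongrightarrow> (LINT y|M. f y)"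
      using f(1)
      by (intro weak_conv_imp_integral_bdd_continuous_conv[OF conv']) (auto simp: continuous_on_eq_continuous_at)
    then show "(\<lambda>n. \<Sum>i\<in>I (s (r n)). w (s (r n)) i * f (x (s (r n)) i)) \<longlonglongrightarrow> (LINT y|M. f y)"
      by (simp add: integral)
  next
    fix m
    have le: "(LINT y|\<mu> (s (r n)). (y ^ m)\<^sup>2) \<le> C m" for n
      using C[of "s (r n)" m] by (subst integral) (auto simp flip: power_mult simp: mult.commute)
    note lim = weak_conv_integral_square_bounded[OF conv' _ int int le]
    show "integrable M (\<lambda>y. y ^ m)" by (rule lim) (auto intro!: continuous_intros)
    have "(\<lambda>n. LINT y|\<mu> (s (r n)). y ^ m) \<longlonglongrightarrow> (LINT y|M. y ^ m)"
      by (rule lim) (auto intro!: continuous_intros)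
    then show "(\<lambda>n. \<Sum>i\<in>I (s (r n)). w (s (r n)) i * x (s (r n)) i ^ m) \<longlonglongrightarrow> (LINT y|M. y ^ m)"
      by (simp add: integral)
  qed
qed

text \<open>If the norm exceeded 1, the direction \<open>c = z\<close> would violate the inequality
  strictly, and so would a nearby point of \<open>D\<close>. With \<open>D\<close> countable, a
  bound on the modulus follows almost everywhere from linear bounds.\<close>

lemma norm_le_1_if_dense:
  fixes z :: complex
  assumes D: "\<And>X :: complex set. open X \<Longrightarrow> X \<noteq> {} \<Longrightarrow> \<exists>d\<in>D. d \<in> X"
    and le: "\<And>c. c \<in> D \<Longrightarrow> Re c * Re z + Im c * Im z \<le> cmod c"
  shows "cmod z \<le> 1"
proof (rule ccontr)
  assume "\<not> ?thesis"
  then have "cmod z < (cmod z)\<^sup>2"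
    using power_strict_increasing[of 1 2 "cmod z"] by simp
  then have "z \<in> {c. cmod c < Re c * Re z + Im c * Im z}"
    by (simp add: cmod_power2 flip: power2_eq_square)
  moreover have "open {c. cmod c < Re c * Re z + Im c * Im z}"
    by (intro open_Collect_less continuous_intros)
  ultimately obtain c where "c \<in> D" "cmod c < Re c * Re z + Im c * Im z" using D by blast
  with le show False by force
qed

text \<open>The complex weights \<open>w\<close> times \<open>h\<close> have a limit dominated by
  \<open>M\<close>, hence a density \<open>G\<close>. It is recovered from limits of probability
  measures, and its bound from linear inequalities in all directions.\<close>

lemma discrete_density_convergent_subseq:
  fixes w x :: "nat \<Rightarrow> 'i \<Rightarrow> real" and h :: "nat \<Rightarrow> 'i \<Rightarrow> complex"
  assumes I: "\<And>n. finite (I n)" and w: "\<And>n i. i \<in> I n \<Longrightarrow> 0 \<le> w n i" "\<And>n. sum (w n) (I n) = 1"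
    and C: "\<And>m n. (\<Sum>i\<in>I n. w n i * x n i ^ (2 * m)) \<le> C m"
    and h: "\<And>n i. i \<in> I n \<Longrightarrow> cmod (h n i) \<le> 1" "\<And>n. (\<Sum>i\<in>I n. of_real (w n i) * h n i) = 0"
  shows "\<exists>r M G. strict_mono (r :: nat \<Rightarrow> nat) \<and> real_distribution M \<and>
    G \<in> borel_measurable borel \<and> (\<forall>y. cmod (G y) \<le> 1) \<and>
    (\<forall>f :: real \<Rightarrow> real. continuous_on UNIV f \<longrightarrow> bounded (range f) \<longrightarrow>
      (\<lambda>n. \<Sum>i\<in>I (r n). w (r n) i * f (x (r n) i)) \<longlonglongrightarrow> (LINT y|M. f y)) \<and>
    (\<forall>m. integrable M (\<lambda>y. y ^ m) \<and>
      (\<lambda>n. \<Sum>i\<in>I (r n). w (r n) i * x (r n) i ^ m) \<longlonglongrightarrow> (LINT y|M. y ^ m) \<and>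
      (\<lambda>n. \<Sum>i\<in>I (r n). of_real (w (r n) i * x (r n) i ^ m) * h (r n) i) \<longlonglongrightarrow>
        (LINT y|M. of_real (y ^ m) * G y))"
proof -
  txt \<open>The shift by 1 makes these weights nonnegative, and by the vanishing mean of \<open>h\<close> they keep
    total mass 1, so that the selection theorem for probability measures applies to them.\<close>
  define u where "u n i = w n i * (1 + Re (h n i))" for n i
  define v where "v n i = w n i * (1 + Im (h n i))" for n i
  have abs_h: "\<bar>Re (h n i)\<bar> \<le> 1" "\<bar>Im (h n i)\<bar> \<le> 1" if "i \<in> I n" for n i
    using h(1)[OF that] abs_Re_le_cmod[of "h n i"] abs_Im_le_cmod[of "h n i"] by linarith+
  have u0: "0 \<le> u n i" and v0: "0 \<le> v n i" and u2: "u n i \<le> 2 * w n i" and v2: "v n i \<le> 2 * w n i"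
    if "i \<in> I n" for n i
    using abs_h[OF that] w(1)[OF that] unfolding u_def v_def
    by (auto simp: mult.commute[of 2] intro!: mult_nonneg_nonneg mult_left_mono)
  have re_im: "(\<Sum>i\<in>I n. w n i * Re (h n i)) = 0" "(\<Sum>i\<in>I n. w n i * Im (h n i)) = 0" for n
    using arg_cong[OF h(2)[of n], of Re] arg_cong[OF h(2)[of n], of Im] by simp_all
  have u1: "sum (u n) (I n) = 1" and v1: "sum (v n) (I n) = 1" for n
    using w(2)[of n] re_im[of n] by (simp_all add: u_def v_def ring_distribs sum.distrib)
  have uC: "(\<Sum>i\<in>I n. u n i * x n i ^ (2 * m)) \<le> 2 * C m"
    and vC: "(\<Sum>i\<in>I n. v n i * x n i ^ (2 * m)) \<le> 2 * C m" for n m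
  proof -
    have "(\<Sum>i\<in>I n. u n i * x n i ^ (2 * m)) \<le> (\<Sum>i\<in>I n. 2 * (w n i * x n i ^ (2 * m)))"
      unfolding mult.assoc[symmetric] by (intro sum_mono mult_right_mono u2) auto
    with C[of n m] show "(\<Sum>i\<in>I n. u n i * x n i ^ (2 * m)) \<le> 2 * C m"
      unfolding sum_distrib_left[symmetric] by linarith
    have "(\<Sum>i\<in>I n. v n i * x n i ^ (2 * m)) \<le> (\<Sum>i\<in>I n. 2 * (w n i * x n i ^ (2 * m)))"
      unfolding mult.assoc[symmetric] by (intro sum_mono mult_right_mono v2) auto
    with C[of n m] show "(\<Sum>i\<in>I n. v n i * x n i ^ (2 * m)) \<le> 2 * C m"
      unfolding sum_distrib_left[symmetric] by linarith
  qed
  have ball: "\<forall>i\<in>I n. 0 \<le> w n i" "\<forall>i\<in>I n. 0 \<le> u n i" "\<forall>i\<in>I n. 0 \<le> v n i" for n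
    using w(1) u0 v0 by auto
  \<comment> \<open>Three successive extractions, each along the previous subsequence, so that a
    single one serves \<open>w\<close>, \<open>u\<close> and \<open>v\<close>.\<close>
  obtain r1 M where r1: "strict_mono (r1 :: nat \<Rightarrow> nat)" and M: "real_distribution M"
    and M1: "\<And>f :: real \<Rightarrow> real. continuous_on UNIV f \<Longrightarrow> bounded (range f) \<Longrightarrow>
      (\<lambda>n. \<Sum>i\<in>I (r1 n). w (r1 n) i * f (x (r1 n) i)) \<longlonglongrightarrow> (LINT y|M. f y)"
    and M2: "\<And>m. integrable M (\<lambda>y. y ^ m)"
      "\<And>m. (\<lambda>n. \<Sum>i\<in>I (r1 n). w (r1 n) i * x (r1 n) i ^ m) \<longlonglongrightarrow> (LINT y|M. y ^ m)"
    using discrete_dist_convergent_subseq[of I w x C "\<lambda>n. n", OF I ball(1) w(2) C strict_mono_id[unfolded id_def]]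
    by (elim exE conjE) blast
  obtain r2 X where r2: "strict_mono (r2 :: nat \<Rightarrow> nat)" and X: "real_distribution X"
    and X1: "\<And>f :: real \<Rightarrow> real. continuous_on UNIV f \<Longrightarrow> bounded (range f) \<Longrightarrow>
      (\<lambda>n. \<Sum>i\<in>I (r1 (r2 n)). u (r1 (r2 n)) i * f (x (r1 (r2 n)) i)) \<longlonglongrightarrow> (LINT y|X. f y)"
    and X2: "\<And>m. integrable X (\<lambda>y. y ^ m)"
      "\<And>m. (\<lambda>n. \<Sum>i\<in>I (r1 (r2 n)). u (r1 (r2 n)) i * x (r1 (r2 n)) i ^ m) \<longlonglongrightarrow> (LINT y|X. y ^ m)"
    using discrete_dist_convergent_subseq[of I u x "\<lambda>m. 2 * C m" r1, OF I ball(2) u1 uC r1]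
    by (elim exE conjE) blast
  have r12: "strict_mono (\<lambda>n. r1 (r2 n))" using strict_mono_o[OF r1 r2] by (simp add: comp_def)
  obtain r3 Y where r3: "strict_mono (r3 :: nat \<Rightarrow> nat)" and Y: "real_distribution Y"
    and Y1: "\<And>f :: real \<Rightarrow> real. continuous_on UNIV f \<Longrightarrow> bounded (range f) \<Longrightarrow>
      (\<lambda>n. \<Sum>i\<in>I (r1 (r2 (r3 n))). v (r1 (r2 (r3 n))) i * f (x (r1 (r2 (r3 n))) i)) \<longlonglongrightarrow> (LINT y|Y. f y)"
    and Y2: "\<And>m. integrable Y (\<lambda>y. y ^ m)"
      "\<And>m. (\<lambda>n. \<Sum>i\<in>I (r1 (r2 (r3 n))). v (r1 (r2 (r3 n))) i * x (r1 (r2 (r3 n))) i ^ m) \<longlonglongrightarrow> (LINT y|Y. y ^ m)"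
    using discrete_dist_convergent_subseq[of I v x "\<lambda>m. 2 * C m" "\<lambda>n. r1 (r2 n)", OF I ball(3) v1 vC r12]
    by (elim exE conjE) blast
  define r where "r n = r1 (r2 (r3 n))" for n
  have r: "strict_mono r" using strict_mono_o[OF r12 r3] by (simp add: comp_def r_def[abs_def])
  note sub3 = LIMSEQ_subseq_LIMSEQ[OF _ r3, unfolded comp_def]
  note sub23 = LIMSEQ_subseq_LIMSEQ[OF _ strict_mono_o[OF r2 r3], unfolded comp_def]
  note limM = sub23[OF M1, folded r_def] and limX = sub3[OF X1, folded r_def] and limY = Y1[folded r_def]
  interpret M: real_distribution M by fact
  interpret X: real_distribution X by fact
  interpret Y: real_distribution Y by fact

  \<comment> \<open>Domination by twice \<open>w\<close> survives the limit on continuous functions,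
    hence on Borel sets; the Radon-Nikodym theorem then supplies a real density.\<close>
  have dom: "\<exists>D. D \<in> borel_measurable borel \<and> (\<forall>y. 0 \<le> D y) \<and> Z = density M (\<lambda>y. ennreal (D y))"
    if Z: "real_distribution Z"
      and lim: "\<And>f :: real \<Rightarrow> real. continuous_on UNIV f \<Longrightarrow> bounded (range f) \<Longrightarrow>
        (\<lambda>n. \<Sum>i\<in>I (r n). q (r n) i * f (x (r n) i)) \<longlonglongrightarrow> (LINT y|Z. f y)"
      and q: "\<And>n i. i \<in> I n \<Longrightarrow> q n i \<le> 2 * w n i" for Z q
  proof -
    interpret Z: real_distribution Z by fact
    have le: "measure Z A \<le> 2 * measure M A" if "A \<in> sets borel" for A
    proof (rule measure_le_if_integral_continuous_le[OF _ _ _ _ _ _ that])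
      fix f :: "real \<Rightarrow> real" assume f: "continuous_on UNIV f" "\<And>y. 0 \<le> f y" "\<And>y. f y \<le> 1"
      then have b: "bounded (range f)" by (auto simp: bounded_iff intro!: exI[of _ 1])
      show "(LINT y|Z. f y) \<le> 2 * (LINT y|M. f y)"
      proof (rule LIMSEQ_le[OF lim[OF f(1) b] tendsto_mult_left[OF limM[OF f(1) b]]])
        have "(\<Sum>i\<in>I (r n). q (r n) i * f (x (r n) i)) \<le> 2 * (\<Sum>i\<in>I (r n). w (r n) i * f (x (r n) i))" for n
          unfolding sum_distrib_left mult.assoc[symmetric] using f by (intro sum_mono mult_right_mono q)
        then show "\<exists>N. \<forall>n\<ge>N. (\<Sum>i\<in>I (r n). q (r n) i * f (x (r n) i)) \<le> 2 * (\<Sum>i\<in>I (r n). w (r n) i * f (x (r n) i))"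
          by blast
      qed
    qed (simp_all add: M.finite_measure_axioms Z.finite_measure_axioms)
    have ac: "absolutely_continuous M Z"
      unfolding absolutely_continuous_def
    proof
      fix A assume A: "A \<in> null_sets M"
      then have "measure M A = 0" "A \<in> sets borel" by (auto simp: null_sets_def measure_def)
      then have "measure Z A = 0" using le[of A] measure_nonneg[of Z A] by linarith
      then show "A \<in> null_sets Z" using \<open>A \<in> sets borel\<close> by (simp add: null_sets_def Z.emeasure_eq_measure)
    qed
    obtain D where D: "D \<in> borel_measurable M" "AE x in M. RN_deriv M Z x = ennreal (D x)" "\<And>x. 0 \<le> D x"
      using M.real_RN_deriv[OF Z.finite_measure_axioms ac] by auto
    have "Z = density M (RN_deriv M Z)" using M.density_RN_deriv[OF ac] by simp
    also have "\<dots> = density M (\<lambda>y. ennreal (D y))"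
      using D by (intro density_cong) auto
    finally have "Z = density M (\<lambda>y. ennreal (D y))" .
    moreover have "borel_measurable M = borel_measurable borel" by (rule measurable_cong_sets) simp_all
    ultimately show ?thesis using D(1,3) by (intro exI[of _ D]) simp
  qed
  obtain D1 where D1[measurable]: "D1 \<in> borel_measurable borel" and D1': "\<And>y. 0 \<le> D1 y" "X = density M (\<lambda>y. ennreal (D1 y))"
    using dom[OF X limX u2] by blast
  obtain D2 where D2[measurable]: "D2 \<in> borel_measurable borel" and D2': "\<And>y. 0 \<le> D2 y" "Y = density M (\<lambda>y. ennreal (D2 y))"
    using dom[OF Y limY v2] by blast
  have intX: "integrable M (\<lambda>y. D1 y * f y)" "(LINT y|X. f y) = (LINT y|M. D1 y * f y)"
    if "integrable X f" for f :: "real \<Rightarrow> real"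
  proof -
    have [measurable]: "f \<in> borel_measurable borel" using that by auto
    show "integrable M (\<lambda>y. D1 y * f y)"
      using that D1' by (simp add: integrable_density)
    show "(LINT y|X. f y) = (LINT y|M. D1 y * f y)"
      using D1' by (simp add: integral_density)
  qed
  have intY: "integrable M (\<lambda>y. D2 y * f y)" "(LINT y|Y. f y) = (LINT y|M. D2 y * f y)"
    if "integrable Y f" for f :: "real \<Rightarrow> real"
  proof -
    have [measurable]: "f \<in> borel_measurable borel" using that by auto
    show "integrable M (\<lambda>y. D2 y * f y)"
      using that D2' by (simp add: integrable_density)
    show "(LINT y|Y. f y) = (LINT y|M. D2 y * f y)"
      using D2' by (simp add: integral_density)
  qed
  \<comment> \<open>Subtracting 1 undoes the shift: these are the densities of the limits of
    \<open>w\<close> times the real and imaginary parts of \<open>h\<close>.\<close>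
  define g1 g2 where "g1 y = D1 y - 1" and "g2 y = D2 y - 1" for y
  have [measurable]: "g1 \<in> borel_measurable borel" "g2 \<in> borel_measurable borel"
    unfolding g1_def g2_def by measurable
  have g_int: "integrable M (\<lambda>y. g1 y * f y)" "(LINT y|M. g1 y * f y) = (LINT y|X. f y) - (LINT y|M. f y)"
    "integrable M (\<lambda>y. g2 y * f y)" "(LINT y|M. g2 y * f y) = (LINT y|Y. f y) - (LINT y|M. f y)"
    if "integrable M f" "integrable X f" "integrable Y f" for f :: "real \<Rightarrow> real"
    using that intX[of f] intY[of f] by (simp_all add: g1_def g2_def left_diff_distrib)
  have bd_int: "integrable M f" "integrable X f" "integrable Y f"
    if f: "continuous_on UNIV f" "\<And>y. 0 \<le> f y" "\<And>y. f y \<le> 1" for f :: "real \<Rightarrow> real"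
  proof -
    have [measurable]: "f \<in> borel_measurable borel" using f(1) by (rule borel_measurable_continuous_onI)
    show "integrable M f" by (rule M.integrable_const_bound[where B = 1]) (use f in auto)
    show "integrable X f" by (rule X.integrable_const_bound[where B = 1]) (use f in auto)
    show "integrable Y f" by (rule Y.integrable_const_bound[where B = 1]) (use f in auto)
  qed
  \<comment> \<open>The combination \<open>a * Re h + b * Im h\<close> is the real part of
    \<open>Complex a b * cnj h\<close>, so it is at most \<open>cmod (Complex a b)\<close>.
    Integrated against nonnegative test functions, this passes to the limit.\<close>
  have g_le: "AE y in M. a * g1 y + b * g2 y \<le> cmod (Complex a b)" for a b
  proof -
    have one: "integrable M (\<lambda>_. 1::real)" "integrable X (\<lambda>_. 1::real)" "integrable Y (\<lambda>_. 1::real)" by auto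
    have "AE y in M. 0 \<le> cmod (Complex a b) - (a * g1 y + b * g2 y)"
    proof (rule AE_nonneg_if_integral_continuous_nonneg)
      show "integrable M (\<lambda>y. cmod (Complex a b) - (a * g1 y + b * g2 y))"
        using g_int(1,3)[OF one] by auto
      fix f :: "real \<Rightarrow> real" assume f: "continuous_on UNIV f" "\<And>y. 0 \<le> f y" "\<And>y. f y \<le> 1"
      then have b: "bounded (range f)" by (auto simp: bounded_iff intro!: exI[of _ 1])
      note int = bd_int[OF f]
      let ?L = "\<lambda>n q. \<Sum>i\<in>I (r n). q (r n) i * f (x (r n) i)"
      have "(LINT y|M. f y * (cmod (Complex a b) - (a * g1 y + b * g2 y))) =
          (LINT y|M. cmod (Complex a b) * f y - (a * (g1 y * f y) + b * (g2 y * f y)))"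
        by (simp add: algebra_simps)
      also have "\<dots> = cmod (Complex a b) * (LINT y|M. f y) -
          (a * ((LINT y|X. f y) - (LINT y|M. f y)) + b * ((LINT y|Y. f y) - (LINT y|M. f y)))"
        using int g_int[OF int] by simp
      finally have eq: "(LINT y|M. f y * (cmod (Complex a b) - (a * g1 y + b * g2 y))) = \<dots>" .
      have lim: "(\<lambda>n. cmod (Complex a b) * ?L n w - (a * (?L n u - ?L n w) + b * (?L n v - ?L n w)))
        \<longlonglongrightarrow> cmod (Complex a b) * (LINT y|M. f y) -
          (a * ((LINT y|X. f y) - (LINT y|M. f y)) + b * ((LINT y|Y. f y) - (LINT y|M. f y)))"
        by (intro tendsto_intros limM limX limY f(1) b)
      have nn: "0 \<le> cmod (Complex a b) * ?L n w - (a * (?L n u - ?L n w) + b * (?L n v - ?L n w))" for n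
      proof -
        have "cmod (Complex a b) * ?L n w - (a * (?L n u - ?L n w) + b * (?L n v - ?L n w)) =
          (\<Sum>i\<in>I (r n). w (r n) i * f (x (r n) i) * (cmod (Complex a b) - (a * Re (h (r n) i) + b * Im (h (r n) i))))"
          by (simp add: u_def v_def sum_distrib_left sum_subtractf sum.distrib algebra_simps)
        also have "\<dots> \<ge> 0"
        proof (intro sum_nonneg mult_nonneg_nonneg w f)
          fix i assume i: "i \<in> I (r n)"
          have "a * Re (h (r n) i) + b * Im (h (r n) i) = Re (Complex a b * cnj (h (r n) i))" by simp
          also have "\<dots> \<le> cmod (Complex a b * cnj (h (r n) i))" by (rule complex_Re_le_cmod)
          also have "\<dots> \<le> cmod (Complex a b)"
            using h(1)[OF i] by (simp add: norm_mult mult_left_le)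
          finally show "0 \<le> cmod (Complex a b) - (a * Re (h (r n) i) + b * Im (h (r n) i))" by simp
        qed
        finally show ?thesis .
      qed
      show "0 \<le> (LINT y|M. f y * (cmod (Complex a b) - (a * g1 y + b * g2 y)))"
        unfolding eq by (rule LIMSEQ_le_const[OF lim]) (intro exI[of _ 0] allI impI nn)
    qed simp
    then show ?thesis by simp
  qed
  obtain D :: "complex set" where D: "countable D" "\<And>X :: complex set. open X \<Longrightarrow> X \<noteq> {} \<Longrightarrow> \<exists>d\<in>D. d \<in> X"
    using countable_dense_setE by blast
  \<comment> \<open>The exceptional null set depends on the direction; restricting to countably many
    directions leaves one null set.\<close>
  have "AE y in M. \<forall>c\<in>D. Re c * g1 y + Im c * g2 y \<le> cmod c"
    using g_le[of "Re c" "Im c" for c] by (subst AE_ball_countable[OF D(1)]) simp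
  then have g_le1: "AE y in M. cmod (Complex (g1 y) (g2 y)) \<le> 1"
    by (rule AE_mp) (auto intro!: AE_I2 norm_le_1_if_dense[OF D(2)])
  \<comment> \<open>Changing the density on a null set makes the bound hold everywhere.\<close>
  define G where "G y = (if cmod (Complex (g1 y) (g2 y)) \<le> 1 then Complex (g1 y) (g2 y) else 0)" for y
  have [measurable]: "G \<in> borel_measurable borel" unfolding G_def Complex_eq by measurable
  have GAE: "AE y in M. G y = Complex (g1 y) (g2 y)"
    using g_le1 by (rule AE_mp) (auto simp: G_def)
  have limG: "(\<lambda>n. \<Sum>i\<in>I (r n). of_real (w (r n) i * x (r n) i ^ m) * h (r n) i) \<longlonglongrightarrow>
        (LINT y|M. of_real (y ^ m) * G y)" for m
  proof -
    note int = M2(1)[of m] X2(1)[of m] Y2(1)[of m]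
    let ?L = "\<lambda>n q. \<Sum>i\<in>I (r n). q (r n) i * x (r n) i ^ m"
    have "(LINT y|M. of_real (y ^ m) * G y) =
      (LINT y|M. of_real (g1 y * y ^ m) + \<i> * of_real (g2 y * y ^ m))"
      using GAE by (intro integral_cong_AE) (auto simp: Complex_eq algebra_simps)
    also have "\<dots> = of_real ((LINT y|X. y ^ m) - (LINT y|M. y ^ m)) + \<i> * of_real ((LINT y|Y. y ^ m) - (LINT y|M. y ^ m))"
      using g_int[OF int] by (simp del: of_real_mult of_real_power of_real_diff)
    finally have eq: "(LINT y|M. of_real (y ^ m) * G y) = \<dots>" .
    have "(\<lambda>n. complex_of_real (?L n u - ?L n w) + \<i> * of_real (?L n v - ?L n w)) \<longlonglongrightarrow>
        of_real ((LINT y|X. y ^ m) - (LINT y|M. y ^ m)) + \<i> * of_real ((LINT y|Y. y ^ m) - (LINT y|M. y ^ m))"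
      by (intro tendsto_intros sub23[OF M2(2)[of m], folded r_def] sub3[OF X2(2)[of m], folded r_def] Y2(2)[of m, folded r_def])
    also have "(\<lambda>n. complex_of_real (?L n u - ?L n w) + \<i> * of_real (?L n v - ?L n w)) =
        (\<lambda>n. \<Sum>i\<in>I (r n). of_real (w (r n) i * x (r n) i ^ m) * h (r n) i)"
      by (auto simp: complex_eq_iff u_def v_def sum_subtractf[symmetric] algebra_simps simp del: of_real_sum intro!: sum.cong)
    finally show ?thesis by (simp only: eq)
  qed
  show ?thesis
    by (intro exI[of _ r] exI[of _ M] exI[of _ G] conjI allI impI r M limM M2(1) limG
        sub23[OF M2(2), folded r_def]) (auto simp: G_def)
qed

section \<open>Realization of moments by biradial measures\<close>

text \<open>The two angles are the argument of \<open>z\<close> plus and minus the arccosine of its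
  modulus; their unit vectors add up to twice that modulus in the direction of
  \<open>z\<close>.\<close>

lemma two_phases_average:
  "\<exists>\<theta>1 \<theta>2. \<theta>1 \<in> borel_measurable borel \<and> \<theta>2 \<in> borel_measurable borel \<and>
    (\<forall>z. cmod z \<le> 1 \<longrightarrow> cis (\<theta>1 z) + cis (\<theta>2 z) = 2 * z)"
proof -
  \<comment> \<open>Clamping keeps \<open>arccos\<close> continuous on the whole line and does not
    affect arguments in [-1,1].\<close>
  define a :: "real \<Rightarrow> real" where "a y = arccos (max (-1) (min 1 y))" for y
  have [measurable]: "a \<in> borel_measurable borel"
    unfolding a_def by (intro borel_measurable_continuous_onI continuous_intros) auto
  have [measurable]: "Arg \<in> borel_measurable borel"
  proof -
    \<comment> \<open>Measurability is obtained by gluing: \<open>Arg\<close> is continuous off the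
      nonpositive real axis and piecewise constant on it.\<close>
    have "Arg = (\<lambda>z. if z \<in> \<real>\<^sub>\<le>\<^sub>0 then (if z = 0 then 0 else pi) else Arg z)"
    proof
      fix z
      show "Arg z = (if z \<in> \<real>\<^sub>\<le>\<^sub>0 then (if z = 0 then 0 else pi) else Arg z)"
      proof (cases "z \<in> \<real>\<^sub>\<le>\<^sub>0 \<and> z \<noteq> 0")
        case True
        then have "Re z < 0 \<and> Im z = 0" by (auto simp: complex_nonpos_Reals_iff complex_eq_iff)
        with True show ?thesis by (simp add: Arg_eq_pi)
      qed (auto simp: Arg_zero)
    qed
    also have "\<dots> \<in> borel_measurable borel"
    proof (subst measurable_If_restrict_space_iff, safe)
      show "{z \<in> space (borel :: complex measure). z \<in> \<real>\<^sub>\<le>\<^sub>0} \<in> sets borel" using borel_closed[OF closed_nonpos_Reals_complex] by simp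
      show "(\<lambda>z::complex. if z = 0 then 0 else pi) \<in> borel_measurable (restrict_space borel {z. z \<in> \<real>\<^sub>\<le>\<^sub>0})"
        by (intro measurable_restrict_space1) measurable
      show "Arg \<in> borel_measurable (restrict_space borel {z. z \<notin> \<real>\<^sub>\<le>\<^sub>0})"
        by (intro borel_measurable_continuous_on_restrict continuous_on_subset[OF continuous_on_Arg]) auto
    qed
    finally show ?thesis .
  qed
  have "cis (Arg z + a (cmod z)) + cis (Arg z - a (cmod z)) = 2 * z" if "cmod z \<le> 1" for z
  proof -
    have "cos (a (cmod z)) = cmod z"
      using that order_trans[of "- 1" 0 "cmod z"] by (simp add: a_def max_def min_def cos_arccos)
    then have "cis (Arg z + a (cmod z)) + cis (Arg z - a (cmod z)) = 2 * rcis (cmod z) (Arg z)"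
      by (simp add: complex_eq_iff cos_add sin_add cos_diff sin_diff)
    then show ?thesis by (simp add: rcis_cmod_Arg)
  qed
  then show ?thesis
    by (intro exI[of _ "\<lambda>z. Arg z + a (cmod z)"] exI[of _ "\<lambda>z. Arg z - a (cmod z)"]) auto
qed

text \<open>The half-lines \<open>{0..}\<close> and \<open>{..<0}\<close> carry the two radial components. Since \<open>M\<close> is symmetric,
  only the odd part of \<open>G\<close> matters, and it is the mean \<open>g\<close> of the two phases.\<close>

lemma biradial_measure_of_symmetric:
  assumes M: "real_distribution M" and sym: "distr M borel uminus = M"
    and int: "\<And>m. integrable M (\<lambda>y. y ^ m)"
    and G: "G \<in> borel_measurable borel" "\<And>y. cmod (G y) \<le> 1"
  shows "\<exists>\<rho>. biradial_measure \<rho> \<and> finite_moments \<rho> \<and>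
    (\<forall>m. (LINT z|\<rho>. r2_monom (2 * m) z) = of_real (LINT y|M. y ^ (2 * m)) \<and>
         (LINT z|\<rho>. r2_monom (2 * m + 1) z) = (LINT y|M. of_real (y ^ (2 * m + 1)) * G y))"
proof -
  interpret real_distribution M by fact
  note G(1)[measurable]
  define g where "g y = (G y - G (- y)) / 2" for y
  have [measurable]: "g \<in> borel_measurable borel" unfolding g_def by measurable
  have g_le: "cmod (g y) \<le> 1" for y
    using norm_triangle_ineq4[of "G y" "G (- y)"] G(2)[of y] G(2)[of "- y"]
    by (simp add: g_def norm_divide)
  obtain \<theta>1 \<theta>2 where [measurable]: "\<theta>1 \<in> borel_measurable borel" "\<theta>2 \<in> borel_measurable borel"
    and \<theta>: "\<And>z. cmod z \<le> 1 \<Longrightarrow> cis (\<theta>1 z) + cis (\<theta>2 z) = 2 * z"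
    using two_phases_average by blast
  define \<phi>1 \<phi>2 where "\<phi>1 r = \<theta>1 (g r)" and "\<phi>2 r = \<theta>2 (g r)" for r
  have [measurable]: "\<phi>1 \<in> borel_measurable borel" "\<phi>2 \<in> borel_measurable borel"
    unfolding \<phi>1_def \<phi>2_def by measurable
  have rcis_meas[measurable]: "(\<lambda>y. rcis (f y) (k y)) \<in> borel_measurable borel"
    if [measurable]: "f \<in> borel_measurable borel" "k \<in> borel_measurable borel" for f k :: "real \<Rightarrow> real"
    unfolding rcis_def cis_conv_exp by measurable
  \<comment> \<open>The sign of \<open>y\<close> selects the phase and \<open>\<bar>y\<bar>\<close>
    is the radius.\<close>
  define \<Phi> where "\<Phi> y = (if 0 \<le> y then rcis y (\<phi>1 y) else rcis (- y) (\<phi>2 (- y)))" for y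
  have \<Phi>[measurable]: "\<Phi> \<in> borel_measurable borel" unfolding \<Phi>_def by measurable
  have norm_\<Phi>: "cmod (\<Phi> y) = \<bar>y\<bar>" for y by (simp add: \<Phi>_def)
  have \<Phi>_sym: "\<Phi> y + \<Phi> (- y) = of_real y * (G y - G (- y))" for y
  proof -
    have *: "rcis r (\<phi>1 r) + rcis r (\<phi>2 r) = of_real r * (G r - G (- r))" for r
    proof -
      have "rcis r (\<phi>1 r) + rcis r (\<phi>2 r) = of_real r * (2 * g r)"
        unfolding \<theta>[OF g_le, symmetric] by (simp add: rcis_def \<phi>1_def \<phi>2_def distrib_left)
      also have "2 * g r = G r - G (- r)" by (simp add: g_def)
      finally show ?thesis .
    qed
    consider "y > 0" | "y = 0" | "y < 0" by linarith
    then show ?thesis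
      using *[of y] *[of "- y"] by cases (auto simp: \<Phi>_def algebra_simps)
  qed
  have int_sym: "(LINT y|M. F (- y)) = (LINT y|M. F y)"
    if [measurable]: "F \<in> borel_measurable borel" for F :: "real \<Rightarrow> complex"
  proof -
    have "(LINT y|M. F y) = (LINT y|distr M borel uminus. F y)" by (simp add: sym)
    also have "\<dots> = (LINT y|M. F (- y))" by (rule integral_distr) simp_all
    finally show ?thesis ..
  qed
  define \<rho> where "\<rho> = distr M borel \<Phi>"
  have "biradial_measure \<rho>"
    unfolding biradial_measure_def
  proof (intro conjI exI ballI)
    let ?\<rho>1 = "restrict_space M {0..}"
    \<comment> \<open>The negative half-line is reflected onto positive radii, so any mass at the
      origin belongs to the first component.\<close>
    let ?\<rho>2 = "distr (restrict_space M {..<0}) (restrict_space borel {0..}) uminus"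
    have um: "uminus \<in> measurable (restrict_space M {..<0}) (restrict_space borel {0::real..})"
    proof (rule measurable_restrict_space2)
      show "uminus \<in> borel_measurable (restrict_space M {..<0})"
        by (rule measurable_restrict_space1) simp
    qed (auto simp: space_restrict_space)
    show "sets ?\<rho>1 = sets (restrict_space borel {0..})"
      by (rule sets_restrict_space_cong) simp
    show "sets ?\<rho>2 = sets (restrict_space borel {0..})" by simp
    have 1: "emeasure ?\<rho>1 A = emeasure M A" if "A \<subseteq> {0..}" for A
      using that by (intro emeasure_restrict_space) auto
    have 2: "emeasure ?\<rho>2 A = emeasure M {y. y < 0 \<and> - y \<in> A}"
      if "A \<in> sets (restrict_space borel {0..})" for A
    proof -
      have "emeasure ?\<rho>2 A = emeasure (restrict_space M {..<0}) (uminus -` A \<inter> space (restrict_space M {..<0}))"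
        by (rule emeasure_distr[OF um that])
      also have "uminus -` A \<inter> space (restrict_space M {..<0}) = {y. y < 0 \<and> - y \<in> A}"
        by (auto simp: space_restrict_space)
      also have "emeasure (restrict_space M {..<0}) \<dots> = emeasure M \<dots>"
        by (rule emeasure_restrict_space) auto
      finally show ?thesis .
    qed
    have split: "emeasure M A = emeasure M (A \<inter> {0..}) + emeasure M (A \<inter> {..<0})" if "A \<in> sets borel" for A
      using that by (subst plus_emeasure) (auto intro!: arg_cong[of _ _ "emeasure M"])
    show "emeasure ?\<rho>1 {0..} + emeasure ?\<rho>2 {0..} = 1"
    proof -
      have "emeasure ?\<rho>2 {0..} = emeasure M ({..<0})"
        by (subst 2) (auto simp: sets_restrict_space intro!: arg_cong[of _ _ "emeasure M"])
      then show ?thesis using split[of UNIV] emeasure_space_1 by (simp add: 1)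
    qed
    show "\<phi>1 \<in> borel_measurable (restrict_space borel {0..})" "\<phi>2 \<in> borel_measurable (restrict_space borel {0..})"
      by (intro measurable_restrict_space1; measurable)+
    fix E :: "complex set" assume E[measurable]: "E \<in> sets borel"
    have "{r. rcis r (\<phi>2 r) \<in> E} \<in> sets borel"
      using measurable_sets[OF rcis_meas[of "\<lambda>r. r" \<phi>2] E] by (simp add: vimage_def)
    then have S: "{r. 0 \<le> r \<and> rcis r (\<phi>2 r) \<in> E} \<in> sets (restrict_space borel {0..})"
      by (auto simp: sets_restrict_space image_iff intro!: bexI[of _ "{r. rcis r (\<phi>2 r) \<in> E}"])
    have "emeasure \<rho> E = emeasure M (\<Phi> -` E)"
      unfolding \<rho>_def by (subst emeasure_distr) simp_all
    also have "\<dots> = emeasure M (\<Phi> -` E \<inter> {0..}) + emeasure M (\<Phi> -` E \<inter> {..<0})"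
      using measurable_sets[OF \<Phi> E] by (intro split) simp
    also have "\<Phi> -` E \<inter> {0..} = {r. 0 \<le> r \<and> rcis r (\<phi>1 r) \<in> E}" by (auto simp: \<Phi>_def)
    also have "emeasure M \<dots> = emeasure ?\<rho>1 \<dots>" by (subst 1) auto
    also have "\<Phi> -` E \<inter> {..<0} = {y. y < 0 \<and> - y \<in> {r. 0 \<le> r \<and> rcis r (\<phi>2 r) \<in> E}}" by (auto simp: \<Phi>_def)
    also have "emeasure M \<dots> = emeasure ?\<rho>2 {r. 0 \<le> r \<and> rcis r (\<phi>2 r) \<in> E}"
      by (rule 2[OF S, symmetric])
    finally show "emeasure \<rho> E = emeasure ?\<rho>1 {r. 0 \<le> r \<and> rcis r (\<phi>1 r) \<in> E}
        + emeasure ?\<rho>2 {r. 0 \<le> r \<and> rcis r (\<phi>2 r) \<in> E}" .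
  qed (simp add: \<rho>_def)
  moreover have "finite_moments \<rho>"
    unfolding finite_moments_def
  proof
    fix n
    have "integrable M (\<lambda>y. \<bar>y ^ n\<bar>)" using int by (rule integrable_abs)
    then show "integrable \<rho> (\<lambda>z. cmod z ^ n)"
      by (simp add: \<rho>_def integrable_distr_eq norm_\<Phi> power_abs)
  qed
  moreover have "(LINT z|\<rho>. r2_monom (2 * m) z) = of_real (LINT y|M. y ^ (2 * m))" for m
  proof -
    have "(LINT z|\<rho>. r2_monom (2 * m) z) = (LINT y|M. r2_monom (2 * m) (\<Phi> y))"
      unfolding \<rho>_def by (rule integral_distr) simp_all
    also have "\<dots> = (LINT y|M. complex_of_real (y ^ (2 * m)))"
      by (simp add: r2_monom_def norm_\<Phi> flip: power_abs)
    also have "\<dots> = of_real (LINT y|M. y ^ (2 * m))" by (rule integral_complex_of_real)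
    finally show ?thesis .
  qed
  moreover have "(LINT z|\<rho>. r2_monom (2 * m + 1) z) = (LINT y|M. of_real (y ^ (2 * m + 1)) * G y)" for m
  proof -
    let ?F = "\<lambda>y. \<Phi> y * of_real (y ^ (2 * m))"
    let ?H = "\<lambda>y. of_real (y ^ (2 * m + 1)) * G y"
    have bdd: "integrable M f"
      if [measurable]: "f \<in> borel_measurable borel" and "\<And>y. cmod (f y) \<le> \<bar>y ^ (2 * m + 1)\<bar>" for f
      by (rule Bochner_Integration.integrable_bound[OF int[of "2 * m + 1"]]) (use that in auto)
    have F: "integrable M ?F" "integrable M (\<lambda>y. ?F (- y))"
      by (auto intro!: bdd simp: norm_mult norm_\<Phi> norm_power abs_mult power_abs)
    have H: "integrable M ?H" "integrable M (\<lambda>y. ?H (- y))"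
      by (auto intro!: bdd mult_left_le G simp: norm_mult norm_power abs_mult power_abs simp del: power_Suc)
    have "(LINT z|\<rho>. r2_monom (2 * m + 1) z) = (LINT y|M. r2_monom (2 * m + 1) (\<Phi> y))"
      unfolding \<rho>_def by (rule integral_distr) simp_all
    also have "\<dots> = (LINT y|M. ?F y)"
      by (simp add: r2_monom_def norm_\<Phi> flip: power_abs)
    finally have eq: "(LINT z|\<rho>. r2_monom (2 * m + 1) z) = (LINT y|M. ?F y)" .
    \<comment> \<open>Averaging over \<open>y\<close> and \<open>- y\<close>, which symmetry of
      \<open>M\<close> permits, combines the two phases at the same radius.\<close>
    have "2 * (LINT y|M. ?F y) = (LINT y|M. ?F y) + (LINT y|M. ?F (- y))"
      by (subst int_sym) simp_all
    also have "\<dots> = (LINT y|M. ?F y + ?F (- y))"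
      by (rule Bochner_Integration.integral_add[OF F, symmetric])
    also have "\<dots> = (LINT y|M. ?H y + ?H (- y))"
    proof (rule Bochner_Integration.integral_cong[OF refl])
      fix y
      have "?F y + ?F (- y) = (\<Phi> y + \<Phi> (- y)) * of_real (y ^ (2 * m))"
        by (simp add: algebra_simps)
      also have "\<dots> = ?H y + ?H (- y)" unfolding \<Phi>_sym by (simp add: algebra_simps)
      finally show "?F y + ?F (- y) = ?H y + ?H (- y)" .
    qed
    also have "\<dots> = (LINT y|M. ?H y) + (LINT y|M. ?H (- y))"
      by (rule Bochner_Integration.integral_add[OF H])
    also have "\<dots> = 2 * (LINT y|M. ?H y)" by (subst int_sym) simp_all
    finally show ?thesis unfolding eq by simp
  qed
  ultimately show ?thesis by (intro exI[of _ \<rho>]) blast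
qed

text \<open>Convergence of the even moments bounds those of the radii, so a subsequence has a limit
  with a density for the phase; two phases realize it. The limits \<open>L\<close> identify its
  moments, since they hold along every subsequence.\<close>

lemma biradial_measure_of_convergent_moments:
  fixes w :: "nat \<Rightarrow> 'i \<Rightarrow> real" and l :: "nat \<Rightarrow> 'i \<Rightarrow> complex"
  assumes I: "\<And>n. finite (I n)" and w: "\<And>n i. i \<in> I n \<Longrightarrow> 0 \<le> w n i" "\<And>n. sum (w n) (I n) = 1"
    and L: "\<And>m. (\<lambda>n. \<Sum>i\<in>I n. of_real (w n i) * r2_monom m (l n i)) \<longlonglongrightarrow> L m"
  shows "\<exists>\<rho>. biradial_measure \<rho> \<and> finite_moments \<rho> \<and> (\<forall>m. (LINT z|\<rho>. r2_monom m z) = L m)"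
proof -
  txt \<open>Each atom is reflected to both half-lines, with opposite phases: this makes the mean phase
    vanish and leaves the odd moments unchanged.\<close>
  define J where "J n = I n \<times> {- 1, 1 :: real}" for n
  define W where "W n p = w n (fst p) / 2" for n and p :: "'i \<times> real"
  define X where "X n p = snd p * cmod (l n (fst p))" for n and p :: "'i \<times> real"
  define H where "H n p = of_real (snd p) * sgn (l n (fst p))" for n and p :: "'i \<times> real"
  have sumJ: "(\<Sum>p\<in>J n. F p) = (\<Sum>i\<in>I n. F (i, - 1) + F (i, 1))" for n and F :: "_ \<Rightarrow> 'c :: comm_monoid_add"
  proof -
    have "(\<Sum>i\<in>I n. F (i, - 1) + F (i, 1)) = (\<Sum>i\<in>I n. \<Sum>e\<in>{- 1, 1 :: real}. F (i, e))" by simp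
    also have "\<dots> = (\<Sum>(i, e)\<in>J n. F (i, e))" unfolding J_def by (rule sum.cartesian_product)
    finally show ?thesis by simp
  qed
  have even: "(\<Sum>p\<in>J n. W n p * X n p ^ (2 * m)) = (\<Sum>i\<in>I n. w n i * cmod (l n i) ^ (2 * m))" for n m
    unfolding sumJ by (simp add: W_def X_def)
  have odd: "(\<Sum>p\<in>J n. of_real (W n p * X n p ^ (2 * m + 1)) * H n p) =
      (\<Sum>i\<in>I n. of_real (w n i) * r2_monom (2 * m + 1) (l n i))" for n m
  proof -
    \<comment> \<open>Separates radius and phase, so that odd moments become integrals of the phase
      density.\<close>
    have "r2_monom (2 * m + 1) z = of_real (cmod z ^ (2 * m + 1)) * sgn z" for z
      by (simp add: r2_monom_def sgn_eq)
    then show ?thesis unfolding sumJ by (simp add: W_def X_def H_def algebra_simps flip: of_real_add)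
  qed
  have lim_even: "(\<lambda>n. \<Sum>i\<in>I n. w n i * cmod (l n i) ^ (2 * m)) \<longlonglongrightarrow> Re (L (2 * m))" for m
    using tendsto_Re[OF L[of "2 * m"]] by (simp add: r2_monom_def del: of_real_power)
  have "\<exists>C. \<forall>n. (\<Sum>p\<in>J n. W n p * X n p ^ (2 * m)) \<le> C" for m
  proof -
    have "Bseq (\<lambda>n. \<Sum>p\<in>J n. W n p * X n p ^ (2 * m))"
      unfolding even using lim_even by (intro convergent_imp_Bseq convergentI)
    then obtain C where "\<And>n. norm (\<Sum>p\<in>J n. W n p * X n p ^ (2 * m)) \<le> C" by (auto simp: Bseq_def)
    then show ?thesis by (intro exI[of _ C]) (auto intro: order_trans[OF abs_ge_self])
  qed
  then obtain C where C: "\<And>m n. (\<Sum>p\<in>J n. W n p * X n p ^ (2 * m)) \<le> C m" by metis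
  have J: "finite (J n)" for n by (simp add: J_def I)
  have W0: "0 \<le> W n p" if "p \<in> J n" for n p using that w(1) by (auto simp: J_def W_def)
  have W1: "sum (W n) (J n) = 1" for n using w(2)[of n] by (simp add: sumJ W_def)
  have H1: "cmod (H n p) \<le> 1" if "p \<in> J n" for n p
    using that by (auto simp: J_def H_def norm_mult norm_sgn)
  have H0: "(\<Sum>p\<in>J n. of_real (W n p) * H n p) = 0" for n by (simp add: sumJ W_def H_def)
  obtain r M G where r: "strict_mono (r :: nat \<Rightarrow> nat)" and M: "real_distribution M"
    and G: "G \<in> borel_measurable borel" "\<And>y. cmod (G y) \<le> 1"
    and lim: "\<And>f :: real \<Rightarrow> real. continuous_on UNIV f \<Longrightarrow> bounded (range f) \<Longrightarrow>
      (\<lambda>n. \<Sum>p\<in>J (r n). W (r n) p * f (X (r n) p)) \<longlonglongrightarrow> (LINT y|M. f y)"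
    and int: "\<And>m. integrable M (\<lambda>y. y ^ m)"
    and limM: "\<And>m. (\<lambda>n. \<Sum>p\<in>J (r n). W (r n) p * X (r n) p ^ m) \<longlonglongrightarrow> (LINT y|M. y ^ m)"
    and limG: "\<And>m. (\<lambda>n. \<Sum>p\<in>J (r n). of_real (W (r n) p * X (r n) p ^ m) * H (r n) p) \<longlonglongrightarrow>
        (LINT y|M. of_real (y ^ m) * G y)"
  proof -
    have "\<exists>r M G. strict_mono (r :: nat \<Rightarrow> nat) \<and> real_distribution M \<and>
      G \<in> borel_measurable borel \<and> (\<forall>y. cmod (G y) \<le> 1) \<and>
      (\<forall>f :: real \<Rightarrow> real. continuous_on UNIV f \<longrightarrow> bounded (range f) \<longrightarrow>
        (\<lambda>n. \<Sum>i\<in>J (r n). W (r n) i * f (X (r n) i)) \<longlonglongrightarrow> (LINT y|M. f y)) \<and>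
      (\<forall>m. integrable M (\<lambda>y. y ^ m) \<and>
        (\<lambda>n. \<Sum>i\<in>J (r n). W (r n) i * X (r n) i ^ m) \<longlonglongrightarrow> (LINT y|M. y ^ m) \<and>
        (\<lambda>n. \<Sum>i\<in>J (r n). of_real (W (r n) i * X (r n) i ^ m) * H (r n) i) \<longlonglongrightarrow>
          (LINT y|M. of_real (y ^ m) * G y))"
      by (rule discrete_density_convergent_subseq[where C = C]) (fact J W0 W1 C H1 H0)+
    then obtain r M G where *: "strict_mono (r :: nat \<Rightarrow> nat)" "real_distribution M"
      "G \<in> borel_measurable borel" "\<forall>y. cmod (G y) \<le> 1"
      "\<forall>f :: real \<Rightarrow> real. continuous_on UNIV f \<longrightarrow> bounded (range f) \<longrightarrow>
        (\<lambda>n. \<Sum>i\<in>J (r n). W (r n) i * f (X (r n) i)) \<longlonglongrightarrow> (LINT y|M. f y)"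
      "\<forall>m. integrable M (\<lambda>y. y ^ m) \<and>
        (\<lambda>n. \<Sum>i\<in>J (r n). W (r n) i * X (r n) i ^ m) \<longlonglongrightarrow> (LINT y|M. y ^ m) \<and>
        (\<lambda>n. \<Sum>i\<in>J (r n). of_real (W (r n) i * X (r n) i ^ m) * H (r n) i) \<longlonglongrightarrow>
          (LINT y|M. of_real (y ^ m) * G y)"
      by (elim exE conjE)
    show ?thesis by (rule that[of r M G]) (simp_all only: *)
  qed
  interpret real_distribution M by fact
  interpret M': real_distribution "distr M borel uminus" by simp
  \<comment> \<open>The reflected atoms carry equal weights, and this symmetry passes to the
    limit.\<close>
  have sym_le: "(LINT y|M. f (- y)) = (LINT y|M. f y)"
    if f: "continuous_on UNIV f" "\<And>y. 0 \<le> f y" "\<And>y. f y \<le> 1" for f :: "real \<Rightarrow> real"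
  proof -
    have b: "bounded (range f)" "bounded (range (\<lambda>y. f (- y)))"
      using f by (auto simp: bounded_iff intro!: exI[of _ 1])
    have "continuous_on UNIV (\<lambda>y. f (- y))"
      by (intro continuous_on_compose2[OF f(1)] continuous_intros) auto
    from lim[OF this b(2)] have "(\<lambda>n. \<Sum>p\<in>J (r n). W (r n) p * f (X (r n) p)) \<longlonglongrightarrow> (LINT y|M. f (- y))"
      by (simp add: sumJ W_def X_def add.commute)
    then show ?thesis using lim[OF f(1) b(1)] by (rule LIMSEQ_unique)
  qed
  have intd: "(LINT y|distr M borel uminus. f y) = (LINT y|M. f (- y))"
    if "continuous_on UNIV f" for f :: "real \<Rightarrow> real"
    using borel_measurable_continuous_onI[OF that] by (intro integral_distr) simp_all
  \<comment> \<open>Domination with constant 1 in both directions turns equality on test functions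
    into equality of measures.\<close>
  have "measure (distr M borel uminus) A = measure M A" if "A \<in> sets borel" for A
  proof (rule antisym)
    have "measure (distr M borel uminus) A \<le> 1 * measure M A"
      by (rule measure_le_if_integral_continuous_le)
        (auto simp: M'.finite_measure_axioms finite_measure_axioms that intd sym_le)
    then show "measure (distr M borel uminus) A \<le> measure M A" by simp
    have "measure M A \<le> 1 * measure (distr M borel uminus) A"
      by (rule measure_le_if_integral_continuous_le)
        (auto simp: M'.finite_measure_axioms finite_measure_axioms that intd sym_le)
    then show "measure M A \<le> measure (distr M borel uminus) A" by simp
  qed
  then have "distr M borel uminus = M"
    by (intro measure_eqI) (auto simp: M'.emeasure_eq_measure emeasure_eq_measure)
  from biradial_measure_of_symmetric[OF M this int G]
  obtain \<rho> where \<rho>: "biradial_measure \<rho>" "finite_moments \<rho>"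
    and e: "\<And>m. (LINT z|\<rho>. r2_monom (2 * m) z) = of_real (LINT y|M. y ^ (2 * m))"
    and o: "\<And>m. (LINT z|\<rho>. r2_monom (2 * m + 1) z) = (LINT y|M. of_real (y ^ (2 * m + 1)) * G y)"
    by auto
  have "(LINT z|\<rho>. r2_monom m z) = L m" for m
  proof (cases "even m")
    case True
    then obtain k where k: "m = 2 * k" by (elim evenE)
    have "(\<lambda>n. \<Sum>i\<in>I (r n). w (r n) i * cmod (l (r n) i) ^ (2 * k)) \<longlonglongrightarrow> (LINT y|M. y ^ (2 * k))"
      using limM[of "2 * k"] by (simp only: even)
    from tendsto_of_real[OF this]
    have "(\<lambda>n. \<Sum>i\<in>I (r n). of_real (w (r n) i) * r2_monom m (l (r n) i)) \<longlonglongrightarrow> of_real (LINT y|M. y ^ (2 * k))"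
      by (simp add: r2_monom_def k)
    then have "(\<lambda>n. \<Sum>i\<in>I (r n). of_real (w (r n) i) * r2_monom m (l (r n) i)) \<longlonglongrightarrow> (LINT z|\<rho>. r2_monom m z)"
      by (simp only: k e)
    then show ?thesis
      using LIMSEQ_subseq_LIMSEQ[OF L[of m] r, unfolded comp_def] by (rule LIMSEQ_unique)
  next
    case False
    then obtain k where k: "m = 2 * k + 1" by (elim oddE)
    have "(\<lambda>n. \<Sum>i\<in>I (r n). of_real (w (r n) i) * r2_monom m (l (r n) i)) \<longlonglongrightarrow> (LINT z|\<rho>. r2_monom m z)"
      using limG[of "2 * k + 1"] unfolding k o by (simp only: odd)
    then show ?thesis
      using LIMSEQ_subseq_LIMSEQ[OF L[of m] r, unfolded comp_def] by (rule LIMSEQ_unique)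
  qed
  with \<rho> show ?thesis by blast
qed

section \<open>Gram--Schmidt orthogonalization\<close>

text \<open>The modulus of the product is the power \<open>i + j\<close> of the radius.\<close>

lemma integrable_r2_monom_mult_cnj:
  assumes "sets \<rho> = sets borel" "finite_moments \<rho>"
  shows "integrable \<rho> (\<lambda>z. r2_monom i z * cnj (r2_monom j z))"
proof -
  have [measurable]: "cnj \<in> borel_measurable borel"
    by (intro borel_measurable_continuous_onI continuous_intros)
  have meas: "(\<lambda>z. r2_monom i z * cnj (r2_monom j z)) \<in> borel_measurable \<rho>"
    unfolding measurable_cong_sets[OF assms(1) refl] by measurable
  have int: "integrable \<rho> (\<lambda>z. cmod z ^ (i + j))" using assms(2) by (simp add: finite_moments_def)
  show ?thesis
    by (rule Bochner_Integration.integrable_bound[OF int meas])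
      (simp add: norm_mult norm_r2_monom power_add)
qed

lemma L2_inner_lincombs:
  assumes B: "\<And>i j. integrable \<rho> (\<lambda>z. B i z * cnj (B j z))"
    and f: "\<And>z. f z = (\<Sum>i<m. c i * B i z)" and g: "\<And>z. g z = (\<Sum>j<n. d j * B j z)"
  shows "integrable \<rho> (\<lambda>z. f z * cnj (g z))"
    and "L2_inner \<rho> f g = (\<Sum>i<m. \<Sum>j<n. c i * cnj (d j) * L2_inner \<rho> (B i) (B j))"
proof -
  have eq: "f z * cnj (g z) = (\<Sum>i<m. \<Sum>j<n. c i * cnj (d j) * (B i z * cnj (B j z)))" for z
    by (simp add: f g sum_product mult_ac)
  show "integrable \<rho> (\<lambda>z. f z * cnj (g z))"
    unfolding eq by (intro Bochner_Integration.integrable_sum integrable_mult_right B)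
  show "L2_inner \<rho> f g = (\<Sum>i<m. \<Sum>j<n. c i * cnj (d j) * L2_inner \<rho> (B i) (B j))"
    unfolding L2_inner_def eq
    by (subst Bochner_Integration.integral_sum
        | intro sum.cong refl Bochner_Integration.integrable_sum integrable_mult_right B
        | simp add: B)+
qed

section \<open>Orthonormality of the recurrence polynomials and its consequences\<close>

context
  fixes \<rho> :: "complex measure" and \<alpha> :: "nat \<Rightarrow> complex" and \<beta> :: "nat \<Rightarrow> real"
  assumes \<beta>: "\<And>j. j \<ge> 1 \<Longrightarrow> \<beta> j > 0"
    and int: "\<And>i j. integrable \<rho> (\<lambda>z. jacobi_poly \<alpha> \<beta> i z * cnj (jacobi_poly \<alpha> \<beta> j z))"
    and on: "\<And>i j. L2_inner \<rho> (jacobi_poly \<alpha> \<beta> i) (jacobi_poly \<alpha> \<beta> j) = (if i = j then 1 else 0)"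
begin

lemma L2_inner_lincombs_jacobi_poly:
  assumes f: "\<And>z. f z = (\<Sum>i<n. c i * jacobi_poly \<alpha> \<beta> i z)"
  shows "L2_inner \<rho> f (jacobi_poly \<alpha> \<beta> j) = (if j < n then c j else 0)"
proof -
  have "L2_inner \<rho> f (jacobi_poly \<alpha> \<beta> j) = (\<Sum>i<n. \<Sum>k<Suc j. c i * cnj (if k = j then 1 else 0) * (if i = k then 1 else 0))"
    by (subst L2_inner_lincombs(2)[OF int f, where n = "Suc j" and d = "\<lambda>k. if k = j then 1 else 0"])
      (simp_all add: on if_distrib[of "\<lambda>x. x * _"] cong: if_cong)
  also have "\<dots> = (\<Sum>i<n. if i = j then c i else 0)"
    by (intro sum.cong refl) (auto simp: if_distrib cong: if_cong)
  finally show ?thesis by simp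
qed

lemma r2_monom_expansion:
  "\<exists>c. \<forall>z. r2_monom n z = (\<Sum>i<n. c i * jacobi_poly \<alpha> \<beta> i z) + of_real (\<Prod>k\<in>{1..n}. \<beta> k) * jacobi_poly \<alpha> \<beta> n z"
proof -
  have "\<And>j. j \<ge> 1 \<Longrightarrow> \<beta> j \<noteq> 0" using \<beta> by force
  from r2_monom_leading[where \<beta> = \<beta> and \<alpha> = \<alpha> and n = n, OF this]
  obtain c where "\<And>z. r2_monom n z - of_real (\<Prod>k\<in>{1..n}. \<beta> k) * jacobi_poly \<alpha> \<beta> n z = (\<Sum>i<n. c i * jacobi_poly \<alpha> \<beta> i z)"
    unfolding lincombs_def by blast
  then show ?thesis by (intro exI[of _ c] allI) (simp add: diff_eq_eq)
qed

text \<open>Uniqueness of Gram-Schmidt: the relation to the monomials is triangular with positive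
  diagonal, so both orthonormal sequences agree.\<close>

lemma orth_poly_eq_jacobi_poly: "orth_poly \<rho> n = jacobi_poly \<alpha> \<beta> n"
proof (induction n rule: less_induct)
  case (less n)
  let ?P = "jacobi_poly \<alpha> \<beta>"
  define D where "D = (\<Prod>k\<in>{1..n}. \<beta> k)"
  have D: "D > 0" unfolding D_def by (intro prod_pos) (auto simp: \<beta>)
  obtain c where c: "\<And>z. r2_monom n z = (\<Sum>i<n. c i * ?P i z) + of_real D * ?P n z"
    using r2_monom_expansion unfolding D_def by blast
  define c' where "c' i = (if i = n then of_real D else c i)" for i
  have c': "r2_monom n z = (\<Sum>i<Suc n. c' i * ?P i z)" for z by (simp add: c c'_def)
  have coeff: "L2_inner \<rho> (r2_monom n) (?P j) = c j" if "j < n" for j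
    using L2_inner_lincombs_jacobi_poly[OF c', of j] that by (simp add: c'_def)
  define q where "q = (\<lambda>z. r2_monom n z - (\<Sum>j<n. L2_inner \<rho> (r2_monom n) (orth_poly \<rho> j) * orth_poly \<rho> j z))"
  \<comment> \<open>By induction the subtracted projections are exactly the lower part of the
    expansion of the monomial.\<close>
  have q: "q = (\<lambda>z. of_real D * ?P n z)"
    unfolding q_def by (rule ext) (simp add: less.IH coeff c)
  have "(LINT z|\<rho>. (cmod (q z))\<^sup>2) = D\<^sup>2"
  proof -
    have "complex_of_real (LINT z|\<rho>. (cmod (q z))\<^sup>2) = (LINT z|\<rho>. of_real ((cmod (q z))\<^sup>2))"
      by (rule integral_complex_of_real[symmetric])
    also have "\<dots> = (LINT z|\<rho>. of_real (D\<^sup>2) * (?P n z * cnj (?P n z)))"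
      by (simp add: q norm_mult power_mult_distrib complex_norm_square
          del: of_real_power flip: of_real_power)
    also have "\<dots> = of_real (D\<^sup>2) * L2_inner \<rho> (?P n) (?P n)"
      unfolding L2_inner_def by (rule integral_mult_right_zero)
    finally show ?thesis by (simp add: on del: of_real_power)
  qed
  then have "L2_norm \<rho> q = D" using D by (simp add: L2_norm_def)
  moreover have "orth_poly \<rho> n = (\<lambda>z. q z / of_real (L2_norm \<rho> q))"
    by (subst orth_poly.simps) (simp add: q_def Let_def)
  ultimately show ?case using D by (simp add: q)
qed

text \<open>In a nontrivial combination with top index \<open>m\<close>, the inner product with the
  polynomial of degree \<open>m\<close> is the top coefficient times a product of positive
  \<open>\<beta>\<close>; for a combination vanishing almost everywhere it is 0.\<close>

lemma r2_monoms_independent_if_jacobi_orthonormal: "r2_monoms_independent \<rho>"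
  unfolding r2_monoms_independent_def
proof (intro allI impI)
  let ?P = "jacobi_poly \<alpha> \<beta>"
  fix n k :: nat and c :: "nat \<Rightarrow> complex"
  assume AE: "AE z in \<rho>. (\<Sum>k\<le>n. c k * r2_monom k z) = 0" and "k \<le> n"
  show "c k = 0"
  proof (rule ccontr)
    assume "c k \<noteq> 0"
    define m where "m = Max {k. k \<le> n \<and> c k \<noteq> 0}"
    have fin: "finite {k. k \<le> n \<and> c k \<noteq> 0}" by simp
    have "m \<in> {k. k \<le> n \<and> c k \<noteq> 0}"
      unfolding m_def by (rule Max_in[OF fin]) (use \<open>k \<le> n\<close> \<open>c k \<noteq> 0\<close> in blast)
    then have m: "m \<le> n" "c m \<noteq> 0" by auto
    have 0: "c k = 0" if "m < k" "k \<le> n" for k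
      using Max_ge[OF fin, of k] that unfolding m_def by fastforce
    define D where "D = (\<Prod>k\<in>{1..m}. \<beta> k)"
    have D: "D > 0" unfolding D_def by (intro prod_pos) (auto simp: \<beta>)
    let ?f = "\<lambda>z. \<Sum>k\<le>n. c k * r2_monom k z"
    have f: "?f z = (\<Sum>k<m. c k * r2_monom k z) + c m * r2_monom m z" for z
    proof -
      have "?f z = (\<Sum>k\<le>m. c k * r2_monom k z)" using m 0 by (intro sum.mono_neutral_right) auto
      then show ?thesis by (simp add: lessThan_Suc_atMost[symmetric])
    qed
    have nz: "\<And>j. j \<ge> 1 \<Longrightarrow> \<beta> j \<noteq> 0" using \<beta> by force
    obtain b where b: "\<And>z. r2_monom m z = (\<Sum>i<m. b i * ?P i z) + of_real D * ?P m z"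
      using r2_monom_expansion unfolding D_def by blast
    have "(\<lambda>z. (\<Sum>k<m. c k * r2_monom k z) + c m * (\<Sum>i<m. b i * ?P i z)) \<in> lincombs ?P m"
    proof (intro lincombs_add lincombs_scale lincombs_sum lincombs_base)
      show "r2_monom k \<in> lincombs ?P m" if "k \<in> {..<m}" for k
        using that by (intro lincombs_mono[OF _ r2_monom_in_lincombs] nz) auto
    qed auto
    then obtain d where d: "\<And>z. (\<Sum>k<m. c k * r2_monom k z) + c m * (\<Sum>i<m. b i * ?P i z) = (\<Sum>i<m. d i * ?P i z)"
      unfolding lincombs_def by blast
    define d' where "d' i = (if i = m then c m * of_real D else d i)" for i
    have "?f z = (\<Sum>i<Suc m. d' i * ?P i z)" for z
    proof -
      have "?f z = ((\<Sum>k<m. c k * r2_monom k z) + c m * (\<Sum>i<m. b i * ?P i z)) + c m * of_real D * ?P m z"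
        unfolding f b[of z] by (simp add: algebra_simps)
      also have "\<dots> = (\<Sum>i<Suc m. d' i * ?P i z)" unfolding d by (simp add: d'_def)
      finally show ?thesis .
    qed
    from L2_inner_lincombs_jacobi_poly[OF this, of m]
    have "L2_inner \<rho> ?f (?P m) = c m * of_real D" by (simp add: d'_def)
    moreover have "L2_inner \<rho> ?f (?P m) = 0"
      unfolding L2_inner_def by (rule integral_eq_zero_AE) (use AE in \<open>auto elim: AE_mp\<close>)
    ultimately show False using m D by simp
  qed
qed

text \<open>The recurrence expands \<open>z * cnj (?P j z)\<close> in the orthonormal polynomials,
  so the parameters are its coefficients at \<open>j\<close> and \<open>j + 1\<close>.\<close>

lemma jacobi_parameters_if_jacobi_orthonormal: "jacobi_parameters \<rho> \<alpha> \<beta>"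
  unfolding jacobi_parameters_def orth_poly_eq_jacobi_poly
proof (intro conjI allI r2_monoms_independent_if_jacobi_orthonormal)
  fix j
  let ?P = "jacobi_poly \<alpha> \<beta>"
  \<comment> \<open>For \<open>j = 0\<close> no index satisfies \<open>Suc i = j\<close>, in
    accordance with the missing third term.\<close>
  define c where "c i = (if i = Suc j then of_real (\<beta> (Suc j)) else if i = j then \<alpha> (Suc j)
    else if Suc i = j then of_real (\<beta> j) else 0)" for i
  have "z * cnj (?P j z) = (\<Sum>i<j + 2. c i * ?P i z)" for z
  proof (cases j)
    case 0
    then show ?thesis using \<beta>[of 1] jacobi_poly_recurrence[of \<beta> 0 z \<alpha>]
      by (simp add: c_def numeral_2_eq_2 del: jacobi_poly.simps)
  next
    case (Suc i)
    have "(\<Sum>k<i. c k * ?P k z) = 0" by (intro sum.neutral) (auto simp: c_def Suc)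
    then show ?thesis using \<beta>[of "Suc j"] jacobi_poly_recurrence[of \<beta> j z \<alpha>]
      by (simp add: c_def Suc numeral_2_eq_2 del: jacobi_poly.simps)
  qed
  from L2_inner_lincombs_jacobi_poly[OF this]
  have "L2_inner \<rho> (\<lambda>z. z * cnj (?P j z)) (?P k) = (if k < j + 2 then c k else 0)" for k .
  then show "\<alpha> (j + 1) = L2_inner \<rho> (\<lambda>z. z * cnj (?P j z)) (?P j)"
    "of_real (\<beta> (j + 1)) = L2_inner \<rho> (\<lambda>z. z * cnj (?P j z)) (?P (j + 1))"
    by (simp_all add: c_def)
qed

end

section \<open>Passage from the quadratures to the biradial measure\<close>

theorem corollary4p2:
  fixes \<alpha> :: "nat \<Rightarrow> complex" and \<beta> :: "nat \<Rightarrow> real"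
  assumes "\<And>j. j \<ge> 1 \<Longrightarrow> \<beta> j > 0"
  shows "\<exists>\<rho> :: complex measure.
           biradial_measure \<rho> \<and> finite_moments \<rho> \<and> jacobi_parameters \<rho> \<alpha> \<beta>"
proof -
  let ?P = "jacobi_poly \<alpha> \<beta>"
  have nz: "\<beta> j \<noteq> 0" if "j \<ge> 1" for j using assms[OF that] by simp
  \<comment> \<open>With \<open>Suc N\<close> the constant polynomial is always included; its norm
    fixes the total mass at 1.\<close>
  define quadrature where "quadrature N V w l \<longleftrightarrow> finite V \<and> (\<forall>v. 0 \<le> w v) \<and>
      (\<forall>i<Suc N. \<forall>j<Suc N. (\<Sum>v\<in>V. of_real (w v) * (?P i (l v) * cnj (?P j (l v)))) = (if i = j then 1 else 0))"
    for N and V :: "(nat \<Rightarrow> complex) set" and w l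
  have "\<forall>N. \<exists>V w l. quadrature N V w l"
    unfolding quadrature_def by (intro allI jacobi_quadrature nz)
  then obtain V w l where "\<And>N. quadrature N (V N) (w N) (l N)" by metis
  then have V: "\<And>N. finite (V N)" and w: "\<And>N v. 0 \<le> w N v"
    and quad: "\<And>N i j. i < Suc N \<Longrightarrow> j < Suc N \<Longrightarrow>
      (\<Sum>v\<in>V N. of_real (w N v) * (?P i (l N v) * cnj (?P j (l N v)))) = (if i = j then 1 else 0)"
    by (auto simp: quadrature_def)
  define S where "S N f g = (\<Sum>v\<in>V N. of_real (w N v) * (f (l N v) * cnj (g (l N v))))"
    for N and f g :: "complex \<Rightarrow> complex"
  have S: "S N f g = (\<Sum>i<m. \<Sum>j<n. c i * cnj (d j) * S N (B i) (B j))"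
    if "\<And>z. f z = (\<Sum>i<m. c i * B i z)" "\<And>z. g z = (\<Sum>j<n. d j * B j z)" for N f g and m n :: nat and c d and B :: "nat \<Rightarrow> complex \<Rightarrow> complex"
  proof -
    have "f z * cnj (g z) = (\<Sum>i<m. \<Sum>j<n. c i * cnj (d j) * (B i z * cnj (B j z)))" for z
      by (simp add: that sum_product mult_ac)
    then have "S N f g = (\<Sum>v\<in>V N. \<Sum>i<m. \<Sum>j<n. c i * cnj (d j) * (of_real (w N v) * (B i (l N v) * cnj (B j (l N v)))))"
      unfolding S_def by (simp add: sum_distrib_left mult_ac)
    also have "\<dots> = (\<Sum>i<m. \<Sum>j<n. c i * cnj (d j) * S N (B i) (B j))"
      unfolding S_def sum_distrib_left by (subst sum.swap, intro sum.cong refl, rule sum.swap)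
    finally show ?thesis .
  qed
  \<comment> \<open>For fixed \<open>i\<close> and \<open>j\<close> the sequence is constant as soon
    as \<open>N\<close> reaches both.\<close>
  have lim_P: "(\<lambda>N. S N (?P i) (?P j)) \<longlonglongrightarrow> (if i = j then 1 else 0)" for i j
    by (rule tendsto_eventually, rule eventually_sequentiallyI[of "max i j"]) (simp add: S_def quad del: jacobi_poly.simps)
  \<comment> \<open>Moments converge because monomials expand in the polynomials with coefficients
    independent of \<open>N\<close>.\<close>
  have "\<exists>L. (\<lambda>N. S N (r2_monom i) (r2_monom 0)) \<longlonglongrightarrow> L" for i
  proof -
    have "r2_monom i \<in> lincombs ?P (Suc i)" by (rule r2_monom_in_lincombs) (rule nz)
    then obtain c where c: "\<And>z. r2_monom i z = (\<Sum>k<Suc i. c k * ?P k z)"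
      unfolding lincombs_def by blast
    have 1: "r2_monom 0 z = (\<Sum>k<Suc 0. 1 * ?P k z)" for z by simp
    have "(\<lambda>N. S N (r2_monom i) (r2_monom 0)) \<longlonglongrightarrow>
        (\<Sum>k<Suc i. \<Sum>j<Suc 0. c k * cnj 1 * (if k = j then 1 else 0))"
      unfolding S[OF c 1] by (intro tendsto_intros lim_P)
    then show ?thesis ..
  qed
  then obtain L where "\<And>i. (\<lambda>N. S N (r2_monom i) (r2_monom 0)) \<longlonglongrightarrow> L i" by metis
  then have L: "(\<lambda>N. \<Sum>v\<in>V N. of_real (w N v) * r2_monom i (l N v)) \<longlonglongrightarrow> L i" for i
    by (simp add: S_def)
  have w1: "sum (w N) (V N) = 1" for N
  proof -
    have "complex_of_real (sum (w N) (V N)) = 1" using quad[of 0 N 0] by simp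
    then show ?thesis by (simp only: of_real_eq_1_iff)
  qed
  obtain \<rho> where \<rho>: "biradial_measure \<rho>" "finite_moments \<rho>" and m: "\<And>i. (LINT z|\<rho>. r2_monom i z) = L i"
    using biradial_measure_of_convergent_moments[of V w l L, OF V w w1 L] by blast
  have sets: "sets \<rho> = sets borel" using \<rho>(1) by (simp add: biradial_measure_def)
  have int: "integrable \<rho> (\<lambda>z. r2_monom i z * cnj (r2_monom j z))" for i j
    by (rule integrable_r2_monom_mult_cnj[OF sets \<rho>(2)])
  have lim_m: "(\<lambda>N. S N (r2_monom i) (r2_monom j)) \<longlonglongrightarrow> L2_inner \<rho> (r2_monom i) (r2_monom j)" for i j
  proof (cases "odd j \<and> even i")
    case True
    then have "L2_inner \<rho> (r2_monom i) (r2_monom j) = (LINT z|\<rho>. cnj (r2_monom (i + j) z))"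
      by (simp add: L2_inner_def r2_monom_mult_cnj)
    also have "\<dots> = cnj (L (i + j))" by (simp add: m)
    finally show ?thesis using tendsto_cnj[OF L[of "i + j"]] True by (simp add: S_def r2_monom_mult_cnj)
  next
    case False
    then have "L2_inner \<rho> (r2_monom i) (r2_monom j) = L (i + j)"
      by (simp add: L2_inner_def r2_monom_mult_cnj m del: de_Morgan_conj)
    then show ?thesis using L[of "i + j"] False by (simp add: S_def r2_monom_mult_cnj del: de_Morgan_conj)
  qed
  have P: "integrable \<rho> (\<lambda>z. ?P i z * cnj (?P j z))"
    "L2_inner \<rho> (?P i) (?P j) = (if i = j then 1 else 0)" for i j
  proof -
    obtain c where c: "\<And>z. ?P i z = (\<Sum>k<Suc i. c k * r2_monom k z)"
      using jacobi_poly_in_lincombs[of \<alpha> \<beta> i] unfolding lincombs_def by blast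
    obtain d where d: "\<And>z. ?P j z = (\<Sum>k<Suc j. d k * r2_monom k z)"
      using jacobi_poly_in_lincombs[of \<alpha> \<beta> j] unfolding lincombs_def by blast
    show "integrable \<rho> (\<lambda>z. ?P i z * cnj (?P j z))" by (rule L2_inner_lincombs(1)[OF int c d])
    \<comment> \<open>Expanding back into monomials identifies the limit with the inner product for
      \<open>\<rho>\<close>; uniqueness of limits then yields orthonormality.\<close>
    have "(\<lambda>N. S N (?P i) (?P j)) \<longlonglongrightarrow> L2_inner \<rho> (?P i) (?P j)"
      unfolding S[OF c d] L2_inner_lincombs(2)[OF int c d] by (intro tendsto_intros lim_m)
    then show "L2_inner \<rho> (?P i) (?P j) = (if i = j then 1 else 0)"
      using lim_P by (rule LIMSEQ_unique)
  qed
  have "jacobi_parameters \<rho> \<alpha> \<beta>"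
    using assms P by (rule jacobi_parameters_if_jacobi_orthonormal)
  with \<rho> show ?thesis by blast
qed

end
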